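(* Let $n\ge 2$ and let $\sigma_2,\sigma_3,\ldots,\sigma_n$ be real numbers. Set $c_l:=\sigma_2+\ldots+\sigma_l+l-1$ for $2\le l\le n$, and assume that for each $l=2,\ldots,n$, $$c_l>0\quad\text{whenever}\quad \sigma_l\ne 0.$$ Let $1<q\le\frac{n}{n-1}$ and $b=\sigma_2-1+\frac{q-1}{q}n$. Then there exists a constant $C>0$ such that for every $w\in C_0^\infty(\mathbb{R}^n)$, $$\int_{\mathbb{R}^n}|\mathbf{X_2}|^{\sigma_2}|\mathbf{X_3}|^{\sigma_3}\cdots|\mathbf{X_n}|^{\sigma_n}|\nabla w|\,dx\ \ge\ C\left(\int_{\mathbb{R}^n}\left(|\mathbf{X_2}|^{b}|\mathbf{X_3}|^{\sigma_3}\cdots|\mathbf{X_n}|^{\sigma_n}|w|\right)^{q}dx\right)^{\frac1q}.$$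
   Context: For $x=(x_1,\ldots,x_n)\in\mathbb{R}^n$ and $1\le k\le n$, $\mathbf{X_k}:=(x_1,\ldots,x_k,0,\ldots,0)$, so $|\mathbf{X_k}|=(x_1^2+\ldots+x_k^2)^{1/2}$; in particular $|\mathbf{X_n}|=|x|$. When $n=2$ the only weights are $|\mathbf{X_2}|^{\sigma_2}$ (left) and $|\mathbf{X_2}|^{b}$ (right). *)

theory Defs
  imports "HOL-Analysis.Analysis"
begin

text \<open>
  A numbering \<open>e\<close> of the index type identifies \<open>x $ e i\<close> with the \<open>i\<close>-th coordinate
  of \<open>x\<close>, for \<open>i = 1, \<dots>, n\<close>. With respect to it, \<open>trunc e k x\<close> is the vector
  \<open>(x\<^sub>1, \<dots>, x\<^sub>k, 0, \<dots>, 0)\<close>.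
\<close>

definition trunc :: "(nat \<Rightarrow> 'n) \<Rightarrow> nat \<Rightarrow> real ^ 'n \<Rightarrow> real ^ 'n::finite" where
  "trunc e k x = (\<chi> i. if i \<in> e ` {1..k} then x $ i else 0)"

definition partial_deriv :: "'n \<Rightarrow> (real ^ 'n \<Rightarrow> real) \<Rightarrow> real ^ 'n::finite \<Rightarrow> real" where
  "partial_deriv i f x = frechet_derivative f (at x) (axis i 1)"

definition grad :: "(real ^ 'n \<Rightarrow> real) \<Rightarrow> real ^ 'n::finite \<Rightarrow> real ^ 'n" where
  "grad f x = (\<chi> i. partial_deriv i f x)"

primrec C_diff :: "nat \<Rightarrow> (real ^ 'n::finite \<Rightarrow> real) \<Rightarrow> bool" where
  "C_diff 0 f \<longleftrightarrow> continuous_on UNIV f"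
| "C_diff (Suc k) f \<longleftrightarrow> (\<forall>x. f differentiable (at x)) \<and> (\<forall>i. C_diff k (partial_deriv i f))"

definition test_functions :: "(real ^ 'n::finite \<Rightarrow> real) set" where
  "test_functions = {f. (\<forall>k. C_diff k f) \<and> compact (closure {x. f x \<noteq> 0})}"

text \<open>
  The product of the weights \<open>|X\<^sub>l|\<close> to the power \<open>\<sigma>\<^sub>l\<close> over \<open>l = m, \<dots>, CARD('n)\<close>.
  Since \<open>0 powr a = 0\<close> for every \<open>a\<close>, including \<open>a \<le> 0\<close>, the weight vanishes where some
  \<open>X\<^sub>l = 0\<close>; for \<open>m \<ge> 2\<close> these points form a Lebesgue null set and do not affect integrals.
\<close>

definition weight :: "(nat \<Rightarrow> 'n) \<Rightarrow> (nat \<Rightarrow> real) \<Rightarrow> nat \<Rightarrow> real ^ 'n::finite \<Rightarrow> real" where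
  "weight e \<sigma> m x = (\<Prod>l=m..CARD('n). norm (trunc e l x) powr \<sigma> l)"

end

theory Submission
  imports Defs
begin

text \<open>
  Write \<open>W\<close> for the weight on the left and \<open>c\<^sub>l = \<sigma>\<^sub>2 + \<dots> + \<sigma>\<^sub>l + l - 1\<close>; the hypothesis
  forces all \<open>c\<^sub>l\<close> to be positive. The vector field \<open>V\<^sub>l = W X\<^sub>l / |X\<^sub>l|\<close> is bounded by
  \<open>W\<close> and has divergence
  \<open>W / |X\<^sub>l| (c\<^sub>l + \<Sum>\<^sub>j\<^sub>>\<^sub>l \<sigma>\<^sub>j |X\<^sub>l|\<^sup>2 / |X\<^sub>j|\<^sup>2)\<close>, so integrating by parts against
  \<open>|w|\<close> and descending from \<open>l = n\<close> to \<open>l = 2\<close> gives the Hardy inequality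
  \<open>\<integral> W |w| / |X\<^sub>2| \<le> K \<integral> W |\<nabla>w|\<close>, the case \<open>q = 1\<close>. As \<open>|\<nabla>W| \<le> K W / |X\<^sub>2|\<close>, the
  Gagliardo--Nirenberg inequality for \<open>W w\<close> then gives the case \<open>q = n / (n - 1)\<close>, and Hoelder's
  inequality interpolates. All derivatives are taken along lines parallel to the axes: almost every such
  line avoids the set \<open>X\<^sub>2 = 0\<close>, where the weights are singular, so no regularisation of \<open>W\<close> is needed.
\<close>

section \<open>Iterated integrals over coordinates\<close>

text \<open>The positivity of all \<open>c_l\<close> is used twice. \<open>c_l\<close> is the factor
  by which the divergence estimate for \<open>V_l\<close> is finally divided; and
  \<open>c_l > 0\<close> says that the exponents
  \<open>\<sigma>_2 - 1, \<sigma>_3, ..., \<sigma>_n\<close> have partial sums up to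
  \<open>l\<close> above \<open>-l\<close>, which makes \<open>W / |X_2|\<close> locally integrable.
  All integrands of the Hardy argument are dominated on cubes by multiples of this function, so
  integrals can be split and rearranged freely. The descent must start at \<open>l = n\<close>
  because \<open>\<sigma>_j\<close> with \<open>j > l\<close> may be negative. Such a term cannot be
  dropped, but it costs at most \<open>|\<sigma>_j| W / |X_j|\<close>, which the inequality already
  proved for \<open>j\<close> controls. Lines miss \<open>X_2 = 0\<close> because that set has
  codimension 2: if all coordinates but one are frozen at nonzero values, \<open>x_1\<close> or
  \<open>x_2\<close> is among them. The interpolation has no free parameter. In
  \<open>(W|w| / |X_2|)^a ((W|w|)^(n/(n-1)))^c\<close>, the conditions \<open>a + c = 1\<close> and
  total degree \<open>q\<close> in \<open>w\<close> force \<open>c = (n-1)(q-1)\<close>; the power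
  of \<open>|X_2|\<close> that results determines \<open>b\<close>, and \<open>a \<ge> 0\<close> is
  the upper bound on \<open>q\<close>.\<close>

definition upd :: "'n \<Rightarrow> real \<Rightarrow> real ^ 'n \<Rightarrow> real ^ 'n::finite" where
  "upd k t x = (\<chi> i. if i = k then t else x $ i)"

text \<open>The argument remains a full vector although its coordinates in \<open>J\<close> are
  integrated out. So \<open>pint J G\<close> lives on the same space for every \<open>J\<close>, and
  an induction over \<open>J\<close> leads from \<open>G\<close> itself to its integral over the
  whole space.\<close>

definition pint :: "'n set \<Rightarrow> (real ^ 'n \<Rightarrow> ennreal) \<Rightarrow> real ^ 'n \<Rightarrow> ennreal" where
  "pint J G x = (\<integral>\<^sup>+y. G (\<chi> i. if i \<in> J then y i else x $ i) \<partial>Pi\<^sub>M (J :: 'n::finite set) (\<lambda>_. lborel))"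

lemma upd_nth [simp]: "upd k t x $ i = (if i = k then t else x $ i)"
  by (simp add: upd_def)

lemma upd_same [simp]: "upd k (x $ k) x = x"
  by (simp add: upd_def vec_eq_iff)

lemma measurable_vec_lambda [measurable (raw)]:
  fixes f :: "'a \<Rightarrow> 'n::finite \<Rightarrow> real"
  assumes "\<And>i. (\<lambda>x. f x i) \<in> borel_measurable M"
  shows "(\<lambda>x. \<chi> i. f x i) \<in> borel_measurable M"
proof (rule borel_measurable_euclidean_space[THEN iffD2], intro ballI)
  fix b :: "real ^ 'n"
  assume "b \<in> Basis"
  then obtain i where "b = axis i 1" by (auto simp: Basis_vec_def)
  then show "(\<lambda>x. (\<chi> i. f x i) \<bullet> b) \<in> borel_measurable M"
    using assms[of i] by (simp add: inner_axis)
qed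

lemma measurable_vec_nth [measurable (raw)]:
  fixes f :: "'a \<Rightarrow> real ^ 'n::finite"
  assumes "f \<in> borel_measurable M"
  shows "(\<lambda>x. f x $ i) \<in> borel_measurable M"
  using assms by (rule borel_measurable_continuous_on[OF continuous_on_component[OF continuous_on_id]])

lemma measurable_upd [measurable (raw)]:
  assumes "f \<in> borel_measurable M" "g \<in> borel_measurable M"
  shows "(\<lambda>z. upd k (f z) (g z)) \<in> borel_measurable M"
proof -
  have "(\<lambda>z. if i = k then f z else g z $ i) \<in> borel_measurable M" for i
    using assms by (cases "i = k") (auto intro: measurable_vec_nth)
  then show ?thesis unfolding upd_def by (rule measurable_vec_lambda)
qed

lemma measurable_merge_vec:
  "(\<lambda>(y, x). \<chi> i. if i \<in> J then y i else x $ i) \<in>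
     borel_measurable (Pi\<^sub>M J (\<lambda>_. lborel) \<Otimes>\<^sub>M (borel :: (real ^ 'n::finite) measure))"
  unfolding split_beta
proof (rule measurable_vec_lambda)
  fix i :: 'n
  show "(\<lambda>x. if i \<in> J then fst x i else snd x $ i) \<in>
    borel_measurable (Pi\<^sub>M J (\<lambda>_. lborel) \<Otimes>\<^sub>M (borel :: (real ^ 'n) measure))"
  proof (cases "i \<in> J")
    case True
    then have "(\<lambda>y. y i) \<in> borel_measurable (Pi\<^sub>M J (\<lambda>_. lborel :: real measure))"
      using measurable_component_singleton[of i J "\<lambda>_. lborel"] by simp
    then show ?thesis using True by (auto intro: measurable_compose[OF measurable_fst])
  next
    case False
    then show ?thesis by (simp add: measurable_vec_nth)
  qed
qed

lemma measurable_merge_vec1: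
  fixes x :: "real ^ 'n::finite"
  shows "(\<lambda>y. \<chi> i. if i \<in> J then y i else x $ i) \<in> borel_measurable (Pi\<^sub>M J (\<lambda>_. lborel))"
  using measurable_compose[OF measurable_Pair2'[of x borel "Pi\<^sub>M J (\<lambda>_. lborel)"] measurable_merge_vec[of J]]
  by simp

lemma measurable_vec_lambda_PiM:
  "(vec_lambda :: _ \<Rightarrow> real ^ 'n::finite) \<in> borel_measurable (Pi\<^sub>M UNIV (\<lambda>_. lborel))"
  using measurable_merge_vec1[of UNIV] by simp

text \<open>Both measures give a box the product of its side lengths, and this determines Lebesgue
  measure. The identity opens the way to Fubini's theorem for products indexed by
  \<open>'n\<close>.\<close>

lemma lborel_vec:
  "(lborel :: (real ^ 'n::finite) measure) = distr (Pi\<^sub>M UNIV (\<lambda>_. lborel)) borel vec_lambda"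
proof (rule lborel_eqI)
  interpret product_sigma_finite "\<lambda>_::'n. lborel :: real measure" by standard
  note m = measurable_vec_lambda_PiM
  fix l u :: "real ^ 'n"
  assume le: "\<And>b. b \<in> Basis \<Longrightarrow> l \<bullet> b \<le> u \<bullet> b"
  have le': "l $ i \<le> u $ i" for i
    using le[of "axis i 1"] by (auto simp: inner_axis Basis_vec_def)
  have "emeasure (distr (Pi\<^sub>M UNIV (\<lambda>_. lborel)) borel vec_lambda) (box l u)
     = emeasure (Pi\<^sub>M UNIV (\<lambda>_. lborel)) (vec_lambda -` box l u \<inter> space (Pi\<^sub>M UNIV (\<lambda>_. lborel)))"
    using m by (simp add: emeasure_distr)
  also have "vec_lambda -` box l u \<inter> space (Pi\<^sub>M UNIV (\<lambda>_::'n. lborel)) = (\<Pi>\<^sub>E i\<in>UNIV. {l $ i<..<u $ i})"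
    by (auto simp: space_PiM mem_box_cart PiE_def Pi_iff)
  also have "emeasure (Pi\<^sub>M UNIV (\<lambda>_. lborel)) \<dots> = (\<Prod>i\<in>UNIV. emeasure lborel {l $ i<..<u $ i})"
    by (rule emeasure_PiM) auto
  also have "\<dots> = (\<Prod>i\<in>UNIV. ennreal (u $ i - l $ i))"
    using le' by simp
  also have "\<dots> = (\<Prod>b\<in>range (\<lambda>i. axis i 1). ennreal ((u - l) \<bullet> b))"
    by (subst prod.reindex) (auto simp: inj_on_def axis_eq_axis inner_axis)
  also have "range (\<lambda>i::'n. axis i (1::real)) = Basis"
    by (auto simp: Basis_vec_def)
  also have "(\<Prod>b\<in>Basis. ennreal ((u - l) \<bullet> b)) = ennreal (\<Prod>b\<in>Basis. (u - l) \<bullet> b)"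
    using le by (intro prod_ennreal) (auto simp: inner_diff_left)
  finally show "emeasure (distr (Pi\<^sub>M UNIV (\<lambda>_. lborel)) borel vec_lambda) (box l u) = \<dots>" .
qed simp

context
  fixes G :: "real ^ 'n::finite \<Rightarrow> ennreal"
  assumes G [measurable]: "G \<in> borel_measurable borel"
begin

interpretation product_sigma_finite "\<lambda>_::'n. lborel :: real measure" by standard

lemma pint_empty: "pint {} G x = G x"
proof -
  have "pint {} G x = (\<integral>\<^sup>+y. G x \<partial>Pi\<^sub>M {} (\<lambda>_::'n. lborel :: real measure))"
    by (simp add: pint_def)
  also have "\<dots> = G x"
    by (simp add: PiM_empty nn_integral_count_space_finite)
  finally show ?thesis .
qed

lemma pint_UNIV: "pint UNIV G x = (\<integral>\<^sup>+x. G x \<partial>lborel)"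
proof -
  note m = measurable_vec_lambda_PiM
  show ?thesis
    by (subst lborel_vec, subst nn_integral_distr) (use m in \<open>auto simp: pint_def\<close>)
qed

lemma measurable_merge_G: "(\<lambda>y. G (\<chi> i. if i \<in> J then y i else x $ i)) \<in> borel_measurable (Pi\<^sub>M J (\<lambda>_. lborel))"
  using measurable_compose[OF measurable_merge_vec1 G] .

lemma measurable_pint [measurable]: "pint J G \<in> borel_measurable borel"
proof -
  interpret finite_product_sigma_finite "\<lambda>_::'n. lborel :: real measure" J by standard simp
  have "(\<lambda>(x, y). G (\<chi> i. if i \<in> J then y i else x $ i)) \<in> borel_measurable (borel \<Otimes>\<^sub>M Pi\<^sub>M J (\<lambda>_. lborel))"
    using measurable_compose[OF measurable_compose[OF measurable_pair_swap' measurable_merge_vec] G, of J]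
    by (simp add: split_beta cong: if_cong)
  from borel_measurable_nn_integral[OF this] show ?thesis
    by (simp add: pint_def[abs_def])
qed

lemma pint_insert:
  assumes "k \<notin> J"
  shows "pint (insert k J) G x = (\<integral>\<^sup>+t. pint J G (upd k t x) \<partial>lborel)"
proof -
  have "pint (insert k J) G x = (\<integral>\<^sup>+t. (\<integral>\<^sup>+y. G (\<chi> i. if i \<in> insert k J then (y(k := t)) i else x $ i)
      \<partial>Pi\<^sub>M J (\<lambda>_. lborel)) \<partial>lborel)"
    unfolding pint_def by (subst product_nn_integral_insert_rev) (use assms measurable_merge_G[of "insert k J"] in auto)
  also have "(\<lambda>t y. \<chi> i. if i \<in> insert k J then (y(k := t)) i else x $ i) =
       (\<lambda>t y. \<chi> i. if i \<in> J then y i else upd k t x $ i)"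
    using assms by (auto simp: fun_eq_iff vec_eq_iff)
  then have "(\<integral>\<^sup>+t. (\<integral>\<^sup>+y. G (\<chi> i. if i \<in> insert k J then (y(k := t)) i else x $ i)
      \<partial>Pi\<^sub>M J (\<lambda>_. lborel)) \<partial>lborel) = (\<integral>\<^sup>+t. pint J G (upd k t x) \<partial>lborel)"
    unfolding pint_def by metis
  finally show ?thesis .
qed

lemma pint_singleton: "pint {k} G x = (\<integral>\<^sup>+t. G (upd k t x) \<partial>lborel)"
  by (simp add: pint_insert pint_empty)

lemma pint_upd:
  assumes "k \<in> J"
  shows "pint J G (upd k t x) = pint J G x"
proof -
  have "(\<lambda>y. \<chi> i. if i \<in> J then y i else upd k t x $ i) = (\<lambda>y. \<chi> i. if i \<in> J then y i else x $ i)"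
    using assms by (auto simp: fun_eq_iff vec_eq_iff)
  then show ?thesis unfolding pint_def by metis
qed

end

text \<open>Fubini with coordinate \<open>k\<close> innermost. Integrability is assumed because
  \<open>h\<close> may change sign, and the sign condition is imposed on every line, not on almost
  every one.\<close>

lemma integral_nonneg_lines:
  fixes h :: "real ^ 'n::finite \<Rightarrow> real"
  assumes h: "integrable lborel h" and pos: "\<And>x. 0 \<le> (LINT t|lborel. h (upd k t x))"
  shows "0 \<le> integral\<^sup>L lborel h"
proof -
  interpret product_sigma_finite "\<lambda>_::'n. lborel :: real measure" by standard
  note m = measurable_vec_lambda_PiM
  have hm [measurable]: "h \<in> borel_measurable borel" using h by auto
  have "integrable (Pi\<^sub>M UNIV (\<lambda>_. lborel)) (\<lambda>y. h (vec_lambda y))"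
    using h m by (subst (asm) lborel_vec) (simp add: integrable_distr_eq)
  then have i: "integrable (Pi\<^sub>M (insert k (- {k})) (\<lambda>_. lborel)) (\<lambda>y. h (vec_lambda y))"
    by (simp add: insert_absorb Compl_eq_Diff_UNIV insert_Diff_single)
  have "integral\<^sup>L lborel h = (\<integral>y. h (vec_lambda y) \<partial>Pi\<^sub>M (insert k (- {k})) (\<lambda>_. lborel))"
    using m by (subst lborel_vec) (simp add: integral_distr Compl_eq_Diff_UNIV insert_Diff_single)
  also have "\<dots> = (\<integral>y. (\<integral>t. h (vec_lambda (y(k := t))) \<partial>lborel) \<partial>Pi\<^sub>M (- {k}) (\<lambda>_. lborel))"
    by (rule product_integral_insert) (use i in auto)
  also have "(\<lambda>y t. vec_lambda (y(k := t))) = (\<lambda>y t. upd k t (vec_lambda y))"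
    by (auto simp: fun_eq_iff vec_eq_iff)
  then have "(\<integral>y. (\<integral>t. h (vec_lambda (y(k := t))) \<partial>lborel) \<partial>Pi\<^sub>M (- {k}) (\<lambda>_. lborel)) =
     (\<integral>y. (\<integral>t. h (upd k t (vec_lambda y)) \<partial>lborel) \<partial>Pi\<^sub>M (- {k}) (\<lambda>_. lborel))"
    by metis
  also have "\<dots> \<ge> 0" by (intro Bochner_Integration.integral_nonneg pos)
  finally show ?thesis .
qed

section \<open>Hoelder and Loomis--Whitney inequalities\<close>

text \<open>Meaningful for \<open>p > 0\<close> only: \<open>epow 0 0 = 0\<close> and \<open>epow top 0 = top\<close>.\<close>

definition epow :: "ennreal \<Rightarrow> real \<Rightarrow> ennreal" where
  "epow x p = (if x = top then top else ennreal (enn2real x powr p))"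

lemma epow_ennreal: "0 \<le> r \<Longrightarrow> epow (ennreal r) p = ennreal (r powr p)"
  by (simp add: epow_def)

lemma epow_0 [simp]: "epow 0 p = 0"
  by (simp add: epow_def)

lemma epow_top [simp]: "epow top p = top"
  by (simp add: epow_def)

lemma epow_eq_0_iff [simp]: "epow x p = 0 \<longleftrightarrow> x = 0"
  by (cases x) (auto simp: epow_def ennreal_eq_0_iff)

lemma epow_eq_top_iff [simp]: "epow x p = top \<longleftrightarrow> x = top"
  by (simp add: epow_def)

lemma epow_mono: "x \<le> y \<Longrightarrow> 0 \<le> p \<Longrightarrow> epow x p \<le> epow y p"
  by (cases x; cases y) (auto simp: epow_ennreal top_unique powr_mono2 intro!: ennreal_leI)

lemma measurable_epow [measurable (raw)]:
  assumes [measurable]: "f \<in> borel_measurable M"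
  shows "(\<lambda>x. epow (f x) p) \<in> borel_measurable M"
  unfolding epow_def by measurable

text \<open>Apply \<open>ln s \<le> s - 1\<close> to \<open>s = y i / m\<close> with
  \<open>m\<close> the weighted mean: the weighted sum of the right sides is zero. A vanishing
  \<open>y i\<close> makes the product zero and is treated apart, since \<open>ln\<close> needs
  positive arguments.\<close>

lemma weighted_arith_geom_mean:
  fixes y p :: "'a \<Rightarrow> real"
  assumes S: "finite S" and p: "\<And>i. i \<in> S \<Longrightarrow> 0 < p i" "sum p S = 1" and y: "\<And>i. i \<in> S \<Longrightarrow> 0 \<le> y i"
  shows "(\<Prod>i\<in>S. y i powr p i) \<le> (\<Sum>i\<in>S. p i * y i)"
proof (cases "\<exists>i\<in>S. y i = 0")
  case True
  then have "(\<Prod>i\<in>S. y i powr p i) = 0" using S by auto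
  then show ?thesis using p y by (simp add: sum_nonneg less_imp_le)
next
  case False
  then have y: "i \<in> S \<Longrightarrow> 0 < y i" for i using y[of i] by force
  have "S \<noteq> {}" using p by auto
  define m where "m = (\<Sum>i\<in>S. p i * y i)"
  have m: "0 < m"
    unfolding m_def using \<open>S \<noteq> {}\<close> S p y by (intro sum_pos) auto
  have "(\<Sum>i\<in>S. p i * ln (y i)) - ln m = (\<Sum>i\<in>S. p i * ln (y i)) - (\<Sum>i\<in>S. p i) * ln m"
    using p by simp
  also have "\<dots> = (\<Sum>i\<in>S. p i * ln (y i / m))"
    unfolding sum_distrib_right sum_subtractf[symmetric]
  proof (intro sum.cong refl)
    fix i assume "i \<in> S"
    then have "y i \<noteq> 0" "m \<noteq> 0" using y m by force+
    then have "ln (y i / m) = ln (y i) - ln m" by (simp add: ln_div)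
    then show "p i * ln (y i) - p i * ln m = p i * ln (y i / m)" by (simp add: right_diff_distrib)
  qed
  also have "\<dots> \<le> (\<Sum>i\<in>S. p i * (y i / m - 1))"
    using y m p by (intro sum_mono mult_left_mono ln_le_minus_one) (auto simp: less_imp_le)
  also have "\<dots> = (\<Sum>i\<in>S. p i * y i) / m - (\<Sum>i\<in>S. p i)"
    by (simp add: right_diff_distrib sum_subtractf sum_divide_distrib)
  also have "\<dots> = m / m - 1"
    unfolding p(2) m_def ..
  also have "\<dots> = 0" using m by simp
  finally have "(\<Sum>i\<in>S. p i * ln (y i)) \<le> ln m" by simp
  then have "exp (\<Sum>i\<in>S. p i * ln (y i)) \<le> m"
    using m ln_ge_iff by blast
  moreover have "(\<Prod>i\<in>S. y i powr p i) = exp (\<Sum>i\<in>S. p i * ln (y i))"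
    unfolding exp_sum[OF S] using y by (intro prod.cong refl) (force simp: powr_def)
  ultimately show ?thesis by (simp add: m_def)
qed

text \<open>The arithmetic-geometric mean inequality for \<open>f i / a i\<close>. The scales
  \<open>a i\<close> are free; Hoelder's inequality takes the integrals of the
  \<open>f i\<close>.\<close>

lemma epow_prod_le_sum:
  fixes a :: "'a \<Rightarrow> real" and f :: "'a \<Rightarrow> ennreal"
  assumes S: "finite S" and p: "\<And>i. i \<in> S \<Longrightarrow> 0 < p i" "sum p S = 1" and a: "\<And>i. i \<in> S \<Longrightarrow> 0 < a i"
  shows "(\<Prod>i\<in>S. epow (f i) (p i)) \<le> ennreal (\<Prod>i\<in>S. a i powr p i) * (\<Sum>i\<in>S. ennreal (p i / a i) * f i)"
proof (cases "\<exists>i\<in>S. f i = top")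
  case True
  have "0 < (\<Prod>i\<in>S. a i powr p i)" using a by (intro prod_pos) (auto simp: less_imp_neq[symmetric])
  moreover obtain i where "i \<in> S" "f i = top" using True by auto
  then have "(\<Sum>i\<in>S. ennreal (p i / a i) * f i) = top"
    using S divide_pos_pos[OF p(1)[of i] a[of i]]
    by (simp add: sum.remove[of _ i] ennreal_mult_top ennreal_eq_0_iff not_le)
  ultimately show ?thesis by (simp add: ennreal_mult_top)
next
  case False
  define r where "r i = enn2real (f i)" for i
  have r: "f i = ennreal (r i)" "0 \<le> r i" if "i \<in> S" for i
    using False that by (auto simp: r_def top.not_eq_extremum)
  have "(\<Prod>i\<in>S. epow (f i) (p i)) = ennreal (\<Prod>i\<in>S. r i powr p i)"
    using r by (simp add: epow_ennreal prod_ennreal cong: prod.cong)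
  also have "(\<Prod>i\<in>S. r i powr p i) = (\<Prod>i\<in>S. a i powr p i) * (\<Prod>i\<in>S. (r i / a i) powr p i)"
    unfolding prod.distrib[symmetric]
    using r a by (intro prod.cong refl) (auto simp: powr_divide less_imp_le less_imp_neq[symmetric])
  also have "\<dots> \<le> (\<Prod>i\<in>S. a i powr p i) * (\<Sum>i\<in>S. p i * (r i / a i))"
    using r a by (intro mult_left_mono weighted_arith_geom_mean S p prod_nonneg) (auto simp: less_imp_le)
  finally have "(\<Prod>i\<in>S. epow (f i) (p i)) \<le> ennreal ((\<Prod>i\<in>S. a i powr p i) * (\<Sum>i\<in>S. p i * (r i / a i)))"
    by (simp add: ennreal_leI)
  also have "\<dots> = ennreal (\<Prod>i\<in>S. a i powr p i) * (\<Sum>i\<in>S. ennreal (p i * (r i / a i)))"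
    using r a p by (subst sum_ennreal) (auto simp: less_imp_le intro!: ennreal_mult prod_nonneg sum_nonneg)
  also have "(\<Sum>i\<in>S. ennreal (p i * (r i / a i))) = (\<Sum>i\<in>S. ennreal (p i / a i) * f i)"
    using r a p by (intro sum.cong) (auto simp: less_imp_le simp flip: ennreal_mult)
  finally show ?thesis .
qed

text \<open>If all integrals are positive and finite, they serve as scales, and integration turns
  the weighted sum into \<open>sum p S = 1\<close>. A zero integral is treated first: as
  \<open>0 * top = 0\<close>, the right side is then zero even beside an infinite factor, so the
  left side has to be shown to vanish.\<close>

lemma nn_integral_Holder:
  fixes f :: "'i \<Rightarrow> 'a \<Rightarrow> ennreal"
  assumes S: "finite S" and p: "\<And>i. i \<in> S \<Longrightarrow> 0 < p i" "sum p S = 1"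
    and f [measurable]: "\<And>i. i \<in> S \<Longrightarrow> f i \<in> borel_measurable M"
  shows "(\<integral>\<^sup>+x. (\<Prod>i\<in>S. epow (f i x) (p i)) \<partial>M) \<le> (\<Prod>i\<in>S. epow (\<integral>\<^sup>+x. f i x \<partial>M) (p i))"
proof (cases "\<exists>i\<in>S. (\<integral>\<^sup>+x. f i x \<partial>M) = 0")
  case True
  then obtain i where i: "i \<in> S" "(\<integral>\<^sup>+x. f i x \<partial>M) = 0" by auto
  then have "AE x in M. f i x = 0" using f by (simp add: nn_integral_0_iff_AE)
  then have "AE x in M. (\<Prod>i\<in>S. epow (f i x) (p i)) = 0"
    by eventually_elim (use i S in auto)
  then have "(\<integral>\<^sup>+x. (\<Prod>i\<in>S. epow (f i x) (p i)) \<partial>M) = (\<integral>\<^sup>+x. 0 \<partial>M)"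
    by (rule nn_integral_cong_AE)
  then show ?thesis by simp
next
  case False
  show ?thesis
  proof (cases "\<exists>i\<in>S. (\<integral>\<^sup>+x. f i x \<partial>M) = top")
    case True
    then have "(\<Prod>i\<in>S. epow (\<integral>\<^sup>+x. f i x \<partial>M) (p i)) = top"
      using False S by (auto simp: ennreal_prod_eq_top)
    then show ?thesis by simp
  next
    case fin: False
    define a where "a i = enn2real (\<integral>\<^sup>+x. f i x \<partial>M)" for i
    have a: "(\<integral>\<^sup>+x. f i x \<partial>M) = ennreal (a i)" "0 < a i" if "i \<in> S" for i
      using False fin that by (auto simp: a_def top.not_eq_extremum enn2real_positive_iff zero_less_iff_neq_zero)
    have "(\<integral>\<^sup>+x. (\<Prod>i\<in>S. epow (f i x) (p i)) \<partial>M)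
       \<le> (\<integral>\<^sup>+x. ennreal (\<Prod>i\<in>S. a i powr p i) * (\<Sum>i\<in>S. ennreal (p i / a i) * f i x) \<partial>M)"
      by (intro nn_integral_mono epow_prod_le_sum S p a(2))
    also have "\<dots> = ennreal (\<Prod>i\<in>S. a i powr p i) * (\<Sum>i\<in>S. ennreal (p i / a i) * ennreal (a i))"
      using S a by (simp add: nn_integral_cmult nn_integral_sum)
    also have "(\<Sum>i\<in>S. ennreal (p i / a i) * ennreal (a i)) = (\<Sum>i\<in>S. ennreal (p i))"
      using a p by (intro sum.cong) (auto simp: less_imp_le less_imp_neq[symmetric] simp flip: ennreal_mult)
    also have "\<dots> = 1" using p by (subst sum_ennreal) (auto simp: less_imp_le)
    also have "ennreal (\<Prod>i\<in>S. a i powr p i) * 1 = (\<Prod>i\<in>S. epow (\<integral>\<^sup>+x. f i x \<partial>M) (p i))"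
      using a by (simp add: epow_ennreal less_imp_le prod_ennreal cong: prod.cong)
    finally show ?thesis .
  qed
qed

text \<open>Induction over the coordinates already integrated. When \<open>x_k\<close> is
  integrated, the factor for \<open>i = k\<close> is constant in it and comes out. The other
  \<open>n - 1\<close> factors have exponent \<open>1 / (n - 1)\<close> each, so Hoelder's
  inequality applies to them.\<close>

lemma Loomis_Whitney_partial:
  fixes G :: "real ^ 'n::finite \<Rightarrow> ennreal"
  assumes G [measurable]: "G \<in> borel_measurable borel" and n: "2 \<le> CARD('n)"
    and F [measurable]: "F \<in> borel_measurable borel"
    and F_le: "\<And>x. F x \<le> (\<Prod>i\<in>UNIV. epow (pint {i} G x) (1 / (CARD('n) - 1)))"
  shows "pint J F x \<le> (\<Prod>i\<in>UNIV. epow (pint (insert i J) G x) (1 / (CARD('n) - 1)))"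
  using finite[of J]
proof (induction J arbitrary: x)
  case empty
  then show ?case using F_le by (simp add: pint_empty)
next
  case (insert k J)
  let ?p = "1 / (real CARD('n) - 1)"
  let ?P = "\<lambda>J x. epow (pint J G x) ?p"
  have split: "(\<Prod>i\<in>UNIV. h i) = h k * (\<Prod>i\<in>-{k}. h i)" for h :: "'n \<Rightarrow> ennreal"
    by (subst prod.remove[of _ k]) (auto simp: Compl_eq_Diff_UNIV)
  have "pint (insert k J) F x = (\<integral>\<^sup>+t. pint J F (upd k t x) \<partial>lborel)"
    using insert by (intro pint_insert F)
  also have "\<dots> \<le> (\<integral>\<^sup>+t. (\<Prod>i\<in>UNIV. ?P (insert i J) (upd k t x)) \<partial>lborel)"
    using insert n by (intro nn_integral_mono) (simp add: of_nat_diff)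
  also have "\<dots> = (\<integral>\<^sup>+t. ?P (insert k J) x * (\<Prod>i\<in>-{k}. ?P (insert i J) (upd k t x)) \<partial>lborel)"
    by (simp add: split pint_upd[OF G])
  also have "\<dots> = ?P (insert k J) x * (\<integral>\<^sup>+t. (\<Prod>i\<in>-{k}. ?P (insert i J) (upd k t x)) \<partial>lborel)"
    by (intro nn_integral_cmult) measurable
  also have "\<dots> \<le> ?P (insert k J) x * (\<Prod>i\<in>-{k}. epow (\<integral>\<^sup>+t. pint (insert i J) G (upd k t x) \<partial>lborel) ?p)"
    using n by (intro mult_left_mono nn_integral_Holder) (auto simp: Compl_eq_Diff_UNIV card_Diff_singleton of_nat_diff)
  also have "(\<Prod>i\<in>-{k}. epow (\<integral>\<^sup>+t. pint (insert i J) G (upd k t x) \<partial>lborel) ?p) = (\<Prod>i\<in>-{k}. ?P (insert i (insert k J)) x)"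
    using insert by (intro prod.cong refl) (auto simp: pint_insert[OF G, symmetric] insert_commute)
  also have "?P (insert k J) x * \<dots> = (\<Prod>i\<in>UNIV. ?P (insert i (insert k J)) x)"
    by (simp add: split)
  finally show ?case using n by (simp add: of_nat_diff)
qed

text \<open>Gagliardo's argument: \<open>f\<close> to the power \<open>n / (n - 1)\<close> is a
  product of \<open>n\<close> equal factors, and each is estimated by the line integral of
  \<open>G\<close> in its own direction. Once all coordinates are integrated, the \<open>n\<close>
  factors on the right coincide.\<close>

lemma nn_integral_Loomis_Whitney:
  fixes G :: "real ^ 'n::finite \<Rightarrow> ennreal"
  assumes G [measurable]: "G \<in> borel_measurable borel" and n: "2 \<le> CARD('n)"
    and f [measurable]: "f \<in> borel_measurable borel" and f0: "\<And>x. 0 \<le> f x"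
    and f_le: "\<And>x i. ennreal (f x) \<le> (\<integral>\<^sup>+t. G (upd i t x) \<partial>lborel)"
  shows "(\<integral>\<^sup>+x. ennreal (f x powr (CARD('n) / (CARD('n) - 1))) \<partial>lborel)
     \<le> epow (\<integral>\<^sup>+x. G x \<partial>lborel) (CARD('n) / (CARD('n) - 1))"
proof -
  define p where "p = 1 / (real CARD('n) - 1)"
  have p: "0 < p" using n by (simp add: p_def)
  have "(\<integral>\<^sup>+x. ennreal (f x powr (CARD('n) / (CARD('n) - 1))) \<partial>lborel)
      = pint UNIV (\<lambda>x. ennreal (f x powr (CARD('n) / (CARD('n) - 1)))) 0"
    by (simp add: pint_UNIV)
  also have "\<dots> \<le> (\<Prod>i\<in>(UNIV::'n set). epow (pint (insert i UNIV) G 0) (1 / (CARD('n) - 1)))"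
  proof (rule Loomis_Whitney_partial[OF G n])
    fix x
    have "ennreal (f x powr (CARD('n) / (CARD('n) - 1))) = epow (ennreal (f x)) p ^ CARD('n)"
      using f0[of x] n by (cases "f x = 0") (simp_all add: epow_ennreal ennreal_power powr_power p_def of_nat_diff)
    also have "\<dots> = (\<Prod>i\<in>(UNIV::'n set). epow (ennreal (f x)) p)" by simp
    also have "\<dots> \<le> (\<Prod>i\<in>UNIV. epow (pint {i} G x) p)"
      using f_le p by (intro prod_mono_ennreal epow_mono) (auto simp: pint_singleton)
    finally show "ennreal (f x powr (CARD('n) / (CARD('n) - 1))) \<le> (\<Prod>i\<in>UNIV. epow (pint {i} G x) (1 / (CARD('n) - 1)))"
      using n by (simp add: p_def of_nat_diff)
  qed measurable
  also have "\<dots> = epow (\<integral>\<^sup>+x. G x \<partial>lborel) p ^ CARD('n)"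
    using n by (simp add: pint_UNIV p_def of_nat_diff)
  also have "\<dots> = epow (\<integral>\<^sup>+x. G x \<partial>lborel) (CARD('n) / (CARD('n) - 1))"
  proof (cases "\<integral>\<^sup>+x. G x \<partial>lborel")
    case (real r)
    then show ?thesis using n
      by (cases "r = 0") (simp_all add: epow_ennreal ennreal_power powr_power p_def of_nat_diff)
  qed (use n in simp)
  finally show ?thesis .
qed

section \<open>One-dimensional estimates\<close>

text \<open>A single null set that serves throughout: off the coordinate hyperplanes every
  \<open>|X_l|\<close> with \<open>l \<ge> 1\<close> is positive.\<close>

lemma AE_lborel_nonzero: "AE x in (lborel :: (real ^ 'n::finite) measure). \<forall>i. x $ i \<noteq> 0"
proof -
  have "AE x in (lborel :: (real ^ 'n) measure). x $ i \<noteq> 0" for i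
  proof -
    have "{x :: real ^ 'n. x $ i = 0} \<in> sets borel" by measurable
    moreover have "{x :: real ^ 'n. x $ i = 0} \<in> null_sets lebesgue"
      using negligible_standard_hyperplane_cart[of i] negligible_iff_null_sets by blast
    ultimately have "{x :: real ^ 'n. x $ i = 0} \<in> null_sets lborel"
      by (simp add: null_sets_completion_iff)
    then show ?thesis by (auto dest: AE_not_in)
  qed
  then show ?thesis by (simp add: AE_all_countable)
qed

lemma nn_integral_prod_coordinates:
  fixes h :: "'n::finite \<Rightarrow> real \<Rightarrow> ennreal"
  assumes [measurable]: "\<And>i. h i \<in> borel_measurable borel"
  shows "(\<integral>\<^sup>+x. (\<Prod>i\<in>UNIV. h i (x $ i)) \<partial>lborel) = (\<Prod>i\<in>UNIV. \<integral>\<^sup>+t. h i t \<partial>lborel)"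
proof -
  interpret product_sigma_finite "\<lambda>_::'n. lborel :: real measure" by standard
  note m = measurable_vec_lambda_PiM
  have "(\<integral>\<^sup>+x. (\<Prod>i\<in>UNIV. h i (x $ i)) \<partial>lborel) = (\<integral>\<^sup>+y. (\<Prod>i\<in>UNIV. h i (y i)) \<partial>Pi\<^sub>M UNIV (\<lambda>_. lborel))"
    by (subst lborel_vec, subst nn_integral_distr) (use m in auto)
  also have "\<dots> = (\<Prod>i\<in>UNIV. \<integral>\<^sup>+t. h i t \<partial>lborel)"
    by (rule product_nn_integral_prod) auto
  finally show ?thesis .
qed

lemma nn_integral_abs_powr_finite:
  fixes a R :: real
  assumes a: "a > -1"
  shows "(\<integral>\<^sup>+t. ennreal (\<bar>t\<bar> powr a) * indicator {-R..R} t \<partial>lborel) < \<infinity>"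
proof -
  define c where "c = max R 0"
  let ?f = "\<lambda>t. ennreal (t powr a) * indicator {0..c} t"
  have I: "(\<integral>\<^sup>+t. ?f t \<partial>lborel) < \<infinity>"
    using nn_integral_has_integral_lebesgue'[OF _ has_integral_powr_from_0[OF a, of c]]
    by (simp add: c_def)
  moreover have "(\<integral>\<^sup>+t. ?f (- t) \<partial>lborel) = (\<integral>\<^sup>+t. ?f t \<partial>lborel)"
    using nn_integral_real_affine[of ?f "-1" 0] by simp
  ultimately have "(\<integral>\<^sup>+t. ?f t + ?f (- t) \<partial>lborel) < \<infinity>"
    by (subst nn_integral_add) auto
  moreover have "(\<integral>\<^sup>+t. ennreal (\<bar>t\<bar> powr a) * indicator {-R..R} t \<partial>lborel) \<le> (\<integral>\<^sup>+t. ?f t + ?f (- t) \<partial>lborel)"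
    by (intro nn_integral_mono) (auto simp: indicator_def c_def abs_if)
  ultimately show ?thesis by (rule le_less_trans[rotated])
qed

lemma integral_compact_line:
  fixes h :: "real \<Rightarrow> real"
  assumes h: "continuous_on UNIV h" and z: "\<And>t. R < \<bar>t\<bar> \<Longrightarrow> h t = 0"
  shows "integrable lborel h" "integral\<^sup>L lborel h = integral {-R..R} h"
proof -
  have eq: "(\<lambda>t. indicat_real {-R..R} t *\<^sub>R h t) = h"
  proof
    fix t show "indicat_real {-R..R} t *\<^sub>R h t = h t"
      using z[of t] by (cases "R < \<bar>t\<bar>") (auto simp: indicator_def)
  qed
  have s: "set_integrable lborel {-R..R} h"
    by (intro borel_integrable_atLeastAtMost' continuous_on_subset[OF h]) auto
  then show "integrable lborel h" unfolding set_integrable_def eq .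
  show "integral\<^sup>L lborel h = integral {-R..R} h"
    using set_borel_integral_eq_integral(2)[OF s] unfolding set_lebesgue_integral_def eq .
qed

text \<open>\<open>\<bar>u\<bar>\<close> is approximated by the smooth function \<open>sqrt (u\<^sup>2 + \<epsilon>\<^sup>2) - \<epsilon>\<close>.\<close>

lemma integral_by_parts_abs:
  fixes v v' u u' :: "real \<Rightarrow> real"
  assumes v: "\<And>t. (v has_real_derivative v' t) (at t)" and v': "continuous_on UNIV v'"
    and u: "\<And>t. (u has_real_derivative u' t) (at t)" and u': "continuous_on UNIV u'"
    and z: "\<And>t. R \<le> \<bar>t\<bar> \<Longrightarrow> u t = 0" "\<And>t. R \<le> \<bar>t\<bar> \<Longrightarrow> u' t = 0" and R: "0 \<le> R"
  shows "0 \<le> (LINT t|lborel. \<bar>v t\<bar> * \<bar>u' t\<bar> - v' t * \<bar>u t\<bar>)"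
proof -
  let ?h = "\<lambda>t. \<bar>v t\<bar> * \<bar>u' t\<bar> - v' t * \<bar>u t\<bar>"
  have cv: "continuous_on UNIV v" and cu: "continuous_on UNIV u"
    using DERIV_continuous_on[OF u] DERIV_continuous_on[OF v] by auto
  have ch: "continuous_on UNIV ?h"
    by (intro continuous_intros cv cu v' u')
  have eq: "integral\<^sup>L lborel ?h = integral {-R..R} ?h"
    by (rule integral_compact_line[OF ch]) (use z in auto)
  have ih: "?h integrable_on {-R..R}"
    by (intro integrable_continuous_interval continuous_on_subset[OF ch]) auto
  \<comment> \<open>\<open>\<epsilon> * K\<close> bounds the error made when \<open>|u|\<close> is
    replaced by its smooth approximation in the term with \<open>v'\<close>.\<close>
  define K where "K = integral {-R..R} (\<lambda>t. \<bar>v' t\<bar>)"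
  have iK: "(\<lambda>t. \<bar>v' t\<bar>) integrable_on {-R..R}"
    by (intro integrable_continuous_interval continuous_intros continuous_on_subset[OF v']) auto
  have K: "0 \<le> K" unfolding K_def by (intro integral_nonneg iK) auto
  have key: "0 \<le> integral {-R..R} ?h + \<epsilon> * K" if e: "0 < \<epsilon>" for \<epsilon> :: real
  proof -
    have p: "0 < (u t)\<^sup>2 + \<epsilon>\<^sup>2" for t using e by (intro add_nonneg_pos) auto
    define \<phi> where "\<phi> t = sqrt ((u t)\<^sup>2 + \<epsilon>\<^sup>2) - \<epsilon>" for t
    define \<phi>' where "\<phi>' t = u t * u' t / sqrt ((u t)\<^sup>2 + \<epsilon>\<^sup>2)" for t
    have d: "((\<lambda>t. v t * \<phi> t) has_real_derivative v' t * \<phi> t + v t * \<phi>' t) (at t)" for t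
    proof -
      have "((\<lambda>t. (u t)\<^sup>2 + \<epsilon>\<^sup>2) has_real_derivative 2 * u t * u' t) (at t)"
        using DERIV_add[OF DERIV_power[OF u, of 2] DERIV_const[of "\<epsilon>\<^sup>2"]] by (simp add: mult_ac)
      note D = DERIV_diff[OF DERIV_chain2[OF DERIV_real_sqrt[OF p] this] DERIV_const[of \<epsilon>]]
      have "inverse (sqrt ((u t)\<^sup>2 + \<epsilon>\<^sup>2)) / 2 * (2 * u t * u' t) - 0 = \<phi>' t"
        by (simp add: \<phi>'_def field_simps)
      with D have "(\<phi> has_real_derivative \<phi>' t) (at t)"
        unfolding \<phi>_def[abs_def] by (simp only:)
      from DERIV_mult[OF v this] show ?thesis by (simp only: mult.commute[of "\<phi>' t"])
    qed
    have i: "((\<lambda>t. v' t * \<phi> t + v t * \<phi>' t) has_integral v R * \<phi> R - v (-R) * \<phi> (-R)) {-R..R}"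
      using R d by (intro fundamental_theorem_of_calculus) (auto simp: has_real_derivative_iff_has_vector_derivative[symmetric] intro: has_field_derivative_at_within)
    \<comment> \<open>Subtracting \<open>\<epsilon>\<close> makes the approximation vanish wherever
      \<open>u\<close> does, so the boundary terms disappear.\<close>
    have "\<phi> R = 0" "\<phi> (-R) = 0" using z R e by (auto simp: \<phi>_def)
    with has_integral_neg[OF i] have i: "((\<lambda>t. - (v' t * \<phi> t + v t * \<phi>' t)) has_integral 0) {-R..R}" by simp
    \<comment> \<open>The derivative of \<open>- v * \<phi>\<close> has integral zero. Pointwise it
      is at most the integrand here, because \<open>\<phi>\<close> differs from \<open>|u|\<close>
      by at most \<open>\<epsilon>\<close> and \<open>|\<phi>'| \<le> |u'|\<close>.\<close>
    have "0 \<le> integral {-R..R} (\<lambda>t. ?h t + \<epsilon> * \<bar>v' t\<bar>)"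
    proof (rule has_integral_le[OF i])
      show "((\<lambda>t. ?h t + \<epsilon> * \<bar>v' t\<bar>) has_integral integral {-R..R} (\<lambda>t. ?h t + \<epsilon> * \<bar>v' t\<bar>)) {-R..R}"
        by (intro integrable_integral integrable_add ih integrable_on_mult_right iK)
      fix t
      have "\<bar>u t\<bar> \<le> sqrt ((u t)\<^sup>2 + \<epsilon>\<^sup>2)" by (simp add: real_le_rsqrt)
      moreover have "sqrt ((u t)\<^sup>2 + \<epsilon>\<^sup>2) \<le> \<bar>u t\<bar> + \<epsilon>"
        using e sqrt_sum_squares_le_sum_abs[of "u t" \<epsilon>] by simp
      ultimately have a: "\<bar>\<phi> t - \<bar>u t\<bar>\<bar> \<le> \<epsilon>" and b: "\<bar>u t\<bar> / sqrt ((u t)\<^sup>2 + \<epsilon>\<^sup>2) \<le> 1"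
        using p[of t] by (auto simp: \<phi>_def divide_le_eq)
      have "- (\<phi>' t * v t) \<le> \<bar>\<phi>' t * v t\<bar>" by simp
      also have "\<dots> = \<bar>u t\<bar> / sqrt ((u t)\<^sup>2 + \<epsilon>\<^sup>2) * (\<bar>v t\<bar> * \<bar>u' t\<bar>)"
        using p[of t] by (simp add: \<phi>'_def abs_mult)
      also have "\<dots> \<le> 1 * (\<bar>v t\<bar> * \<bar>u' t\<bar>)" by (intro mult_right_mono b) auto
      finally have A: "- (v t * \<phi>' t) \<le> \<bar>v t\<bar> * \<bar>u' t\<bar>" by (simp add: mult.commute)
      have "v' t * (\<bar>u t\<bar> - \<phi> t) \<le> \<epsilon> * \<bar>v' t\<bar>"
      proof -
        have "v' t * (\<bar>u t\<bar> - \<phi> t) \<le> \<bar>v' t\<bar> * \<bar>\<phi> t - \<bar>u t\<bar>\<bar>" by (metis abs_ge_self abs_minus_commute abs_mult)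
        also have "\<dots> \<le> \<bar>v' t\<bar> * \<epsilon>" by (intro mult_left_mono a) auto
        finally show ?thesis by (simp add: mult.commute)
      qed
      with A show "- (v' t * \<phi> t + v t * \<phi>' t) \<le> ?h t + \<epsilon> * \<bar>v' t\<bar>"
        by (simp add: right_diff_distrib)
    qed
    then show ?thesis by (simp add: K_def integral_add ih iK integrable_on_mult_right)
  qed
  have "0 \<le> integral {-R..R} ?h"
  proof (rule field_le_epsilon)
    fix \<delta> :: real assume "0 < \<delta>"
    \<comment> \<open>The choice of \<open>\<epsilon>\<close>; \<open>+ 1\<close> guards against
      \<open>K = 0\<close>.\<close>
    then have "0 < \<delta> / (K + 1)" and "\<delta> / (K + 1) * K \<le> \<delta>"
      using K mult_left_mono[of K "K + 1" "\<delta>"] by (simp_all add: divide_le_eq)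
    with key[of "\<delta> / (K + 1)"] show "0 \<le> integral {-R..R} ?h + \<delta>" by linarith
  qed
  then show ?thesis by (simp add: eq)
qed

text \<open>The fundamental theorem of calculus from \<open>-R\<close>, where \<open>u\<close>
  vanishes. It supplies the bound by line integrals that the Loomis--Whitney inequality asks
  for.\<close>

lemma abs_le_nn_integral_derivative:
  fixes u u' :: "real \<Rightarrow> real"
  assumes u: "\<And>t. (u has_real_derivative u' t) (at t)" and u': "continuous_on UNIV u'"
    and z: "\<And>t. R \<le> \<bar>t\<bar> \<Longrightarrow> u t = 0" and R: "0 \<le> R"
  shows "ennreal \<bar>u s\<bar> \<le> (\<integral>\<^sup>+t. ennreal \<bar>u' t\<bar> \<partial>lborel)"
proof (cases "\<bar>s\<bar> \<le> R")
  case True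
  have "(u' has_integral u s - u (-R)) {-R..s}"
    using True u by (intro fundamental_theorem_of_calculus)
      (auto simp: has_real_derivative_iff_has_vector_derivative[symmetric] intro: has_field_derivative_at_within)
  then have I: "(u' has_integral u s) {-R..s}" using z[of "-R"] R by simp
  have J: "(\<lambda>t. \<bar>u' t\<bar>) integrable_on {-R..s}"
    by (intro integrable_continuous_interval continuous_intros continuous_on_subset[OF u']) auto
  have "\<bar>u s\<bar> \<le> integral {-R..s} (\<lambda>t. \<bar>u' t\<bar>)"
    using integral_norm_bound_integral[OF has_integral_integrable[OF I] J] integral_unique[OF I] by simp
  then have "ennreal \<bar>u s\<bar> \<le> ennreal (integral {-R..s} (\<lambda>t. \<bar>u' t\<bar>))" by (rule ennreal_leI)
  also have "\<dots> = (\<integral>\<^sup>+t. ennreal \<bar>u' t\<bar> * indicator {-R..s} t \<partial>lborel)"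
    by (rule nn_integral_has_integral_lebesgue'[OF _ integrable_integral[OF J], symmetric]) auto
  also have "\<dots> \<le> (\<integral>\<^sup>+t. ennreal \<bar>u' t\<bar> \<partial>lborel)"
    by (intro nn_integral_mono) (auto simp: indicator_def)
  finally show ?thesis .
qed (use z[of s] in auto)

section \<open>Local integrability of the weights\<close>

lemma norm_trunc: "norm (trunc e l x) = sqrt (\<Sum>i\<in>e ` {1..l}. (x $ i)\<^sup>2)"
proof -
  have "(\<Sum>i\<in>UNIV. (trunc e l x $ i)\<^sup>2) = (\<Sum>i\<in>UNIV. if i \<in> e ` {1..l} then (x $ i)\<^sup>2 else 0)"
    by (intro sum.cong) (auto simp: trunc_def)
  also have "\<dots> = (\<Sum>i\<in>e ` {1..l}. (x $ i)\<^sup>2)"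
    by (subst sum.inter_restrict[symmetric]) auto
  finally show ?thesis by (simp add: norm_vec_def L2_set_def)
qed

lemma norm_trunc_mono: "l \<le> m \<Longrightarrow> norm (trunc e l x) \<le> norm (trunc e m x)"
  unfolding norm_trunc by (intro real_sqrt_le_mono sum_mono2) auto

lemma abs_le_norm_trunc: "i \<in> e ` {1..l} \<Longrightarrow> \<bar>x $ i\<bar> \<le> norm (trunc e l x)"
  using component_le_norm_cart[of "trunc e l x" i] by (simp add: trunc_def)

lemma norm_trunc_le: "norm (trunc e l x) \<le> norm x"
  by (intro norm_le_componentwise_cart) (simp add: trunc_def)

lemma norm_trunc_pos: "i \<in> e ` {1..l} \<Longrightarrow> x $ i \<noteq> 0 \<Longrightarrow> 0 < norm (trunc e l x)"
  using abs_le_norm_trunc[of i e l x] by linarith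

lemma measurable_norm_trunc [measurable]:
  fixes e :: "nat \<Rightarrow> 'n::finite"
  shows "(\<lambda>x. norm (trunc e l x)) \<in> borel_measurable borel"
proof -
  have "(\<lambda>x :: real ^ 'n. if i \<in> e ` {1..l} then x $ i else 0) \<in> borel_measurable borel" for i
    using measurable_vec_nth[of "\<lambda>x :: real ^ 'n. x" borel i] by (cases "i \<in> e ` {1..l}") simp_all
  then have "(\<lambda>x. trunc e l x) \<in> borel_measurable borel"
    unfolding trunc_def by (intro measurable_vec_lambda)
  from measurable_compose[OF this borel_measurable_norm] show ?thesis .
qed

lemma measurable_weight [measurable]: "weight e \<tau> m \<in> borel_measurable borel"
  unfolding weight_def[abs_def] by measurable

lemma weight_nonneg: "0 \<le> weight e \<tau> m x"
  unfolding weight_def by (intro prod_nonneg) auto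

text \<open>
  Surplus positive powers are carried over to the next norm (exponent \<open>\<kappa>\<close>); negative powers of
  \<open>|X\<^sub>l|\<close> are distributed over the coordinates \<open>x\<^sub>1, \<dots>, x\<^sub>l\<close> so that each exponent \<open>A i\<close>
  stays below the integrability threshold 1.
\<close>

lemma prod_norm_trunc_le:
  fixes e :: "nat \<Rightarrow> 'n::finite" and \<tau> :: "nat \<Rightarrow> real"
  assumes "1 \<le> m" and "\<And>l. l \<in> {2..m} \<Longrightarrow> - real l < (\<Sum>j=2..l. \<tau> j)"
  shows "\<exists>A \<kappa>. 0 \<le> \<kappa> \<and> (\<forall>i\<in>{1..m}. 0 \<le> A i \<and> A i < 1) \<and> \<kappa> - (\<Sum>i=1..m. A i) = (\<Sum>j=2..m. \<tau> j) \<and>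
    (\<forall>x :: real ^ 'n. (\<forall>i. x $ i \<noteq> 0) \<longrightarrow>
      (\<Prod>l=2..m. norm (trunc e l x) powr \<tau> l) \<le> (\<Prod>i=1..m. \<bar>x $ e i\<bar> powr - A i) * norm (trunc e m x) powr \<kappa>)"
  using assms
proof (induction m rule: nat_induct_at_least)
  case base
  have "0 < norm (trunc e 1 x)" if "\<forall>i. x $ i \<noteq> 0" for x :: "real ^ 'n"
    using that by (intro norm_trunc_pos[of "e 1"]) auto
  then show ?case
    by (intro exI[of _ "\<lambda>_. 0"] exI[of _ 0]) auto
next
  case (Suc m)
  have "- real l < (\<Sum>j=2..l. \<tau> j)" if "l \<in> {2..m}" for l
    using Suc.prems[of l] that by simp
  from Suc.IH[OF this] obtain A \<kappa> where \<kappa>: "0 \<le> \<kappa>" and A: "\<And>i. i \<in> {1..m} \<Longrightarrow> 0 \<le> A i \<and> A i < 1"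
    and s: "\<kappa> - (\<Sum>i=1..m. A i) = (\<Sum>j=2..m. \<tau> j)"
    and le: "\<And>x :: real ^ 'n. (\<forall>i. x $ i \<noteq> 0) \<Longrightarrow>
      (\<Prod>l=2..m. norm (trunc e l x) powr \<tau> l) \<le> (\<Prod>i=1..m. \<bar>x $ e i\<bar> powr - A i) * norm (trunc e m x) powr \<kappa>"
    by blast
  \<comment> \<open>The new coordinate enters with exponent 0 and takes a share only if a negative
    power has to be distributed.\<close>
  define B where "B i = (if i = Suc m then 0 else A i)" for i
  have B: "0 \<le> B i \<and> B i < 1" if "i \<in> {1..Suc m}" for i
    using A[of i] that by (auto simp: B_def)
  have sB: "(\<Sum>i=1..Suc m. B i) = (\<Sum>i=1..m. A i)"
    by (simp add: B_def)
  have s': "(\<Sum>j=2..Suc m. \<tau> j) = \<kappa> + \<tau> (Suc m) - (\<Sum>i=1..Suc m. B i)"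
    using Suc.hyps s unfolding sB by simp
  have step: "(\<Prod>l=2..Suc m. norm (trunc e l x) powr \<tau> l) \<le>
      (\<Prod>i=1..Suc m. \<bar>x $ e i\<bar> powr - B i) * norm (trunc e (Suc m) x) powr (\<kappa> + \<tau> (Suc m))"
    if x: "\<forall>i. x $ i \<noteq> 0" for x :: "real ^ 'n"
  proof -
    let ?\<rho> = "norm (trunc e (Suc m) x)"
    have pB: "(\<Prod>i=1..Suc m. \<bar>x $ e i\<bar> powr - B i) = (\<Prod>i=1..m. \<bar>x $ e i\<bar> powr - A i)"
      using x by (simp add: B_def)
    have "(\<Prod>l=2..Suc m. norm (trunc e l x) powr \<tau> l) = (\<Prod>l=2..m. norm (trunc e l x) powr \<tau> l) * ?\<rho> powr \<tau> (Suc m)"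
      using Suc.hyps by simp
    also have "\<dots> \<le> ((\<Prod>i=1..m. \<bar>x $ e i\<bar> powr - A i) * norm (trunc e m x) powr \<kappa>) * ?\<rho> powr \<tau> (Suc m)"
      by (intro mult_right_mono le x) auto
    \<comment> \<open>Passing to the larger norm is allowed because \<open>\<kappa> \<ge> 0\<close>;
      this is why the surplus is kept nonnegative.\<close>
    also have "\<dots> \<le> ((\<Prod>i=1..m. \<bar>x $ e i\<bar> powr - A i) * ?\<rho> powr \<kappa>) * ?\<rho> powr \<tau> (Suc m)"
      using \<kappa> by (intro mult_right_mono mult_left_mono powr_mono2 norm_trunc_mono prod_nonneg) auto
    also have "\<dots> = (\<Prod>i=1..Suc m. \<bar>x $ e i\<bar> powr - B i) * ?\<rho> powr (\<kappa> + \<tau> (Suc m))"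
      unfolding pB by (simp add: powr_add)
    finally show ?thesis .
  qed
  show ?case
  proof (cases "0 \<le> \<kappa> + \<tau> (Suc m)")
    case True
    with B s' step show ?thesis
      by (intro exI[of _ B] exI[of _ "\<kappa> + \<tau> (Suc m)"]) (auto simp del: sum.cl_ivl_Suc prod.cl_ivl_Suc)
  next
    case False
    define a where "a = - (\<kappa> + \<tau> (Suc m))"
    define d where "d = real (Suc m) - (\<Sum>i=1..Suc m. B i)"
    \<comment> \<open>\<open>d\<close> is the sum of the gaps \<open>1 - B i\<close>, the total room
      below the threshold. The hypothesis on the partial sums gives \<open>a < d\<close>, so closing
      the same fraction \<open>\<theta> < 1\<close> of every gap absorbs exactly \<open>a\<close>
      and leaves each exponent below 1.\<close>
    define \<theta> where "\<theta> = a / d"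
    define B' where "B' i = B i + \<theta> * (1 - B i)" for i
    have a: "0 < a" using False by (simp add: a_def)
    have "a < d"
      using Suc.prems[of "Suc m"] Suc.hyps s' by (simp add: a_def d_def)
    with a have \<theta>: "0 < \<theta>" "\<theta> < 1" "\<theta> * d = a" by (auto simp: \<theta>_def)
    have B': "0 \<le> B' i \<and> B' i < 1" if "i \<in> {1..Suc m}" for i
    proof
      show "0 \<le> B' i" using B[OF that] \<theta> by (simp add: B'_def)
      have "\<theta> * (1 - B i) < 1 * (1 - B i)" using B[OF that] \<theta> by (intro mult_strict_right_mono) auto
      then show "B' i < 1" by (simp add: B'_def)
    qed
    have d: "(\<Sum>i=1..Suc m. \<theta> * (1 - B i)) = a"
      unfolding sum_distrib_left[symmetric] sum_subtractf using \<theta>(3) by (simp add: d_def)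
    have "0 - (\<Sum>i=1..Suc m. B' i) = (\<Sum>j=2..Suc m. \<tau> j)"
      unfolding B'_def sum.distrib d s' by (simp add: a_def)
    moreover have "(\<Prod>l=2..Suc m. norm (trunc e l x) powr \<tau> l) \<le>
      (\<Prod>i=1..Suc m. \<bar>x $ e i\<bar> powr - B' i) * norm (trunc e (Suc m) x) powr 0"
      if x: "\<forall>i. x $ i \<noteq> 0" for x :: "real ^ 'n"
    proof -
      let ?\<rho> = "norm (trunc e (Suc m) x)"
      have \<rho>: "0 < ?\<rho>" using x by (intro norm_trunc_pos[of "e 1"]) auto
      have "?\<rho> powr (\<kappa> + \<tau> (Suc m)) = ?\<rho> powr (\<Sum>i=1..Suc m. - (\<theta> * (1 - B i)))"
        unfolding sum_negf d by (simp only: a_def minus_minus)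
      also have "\<dots> = (\<Prod>i=1..Suc m. ?\<rho> powr - (\<theta> * (1 - B i)))"
        using \<rho> by (intro powr_sum) auto
      \<comment> \<open>Every \<open>|x_i|\<close> is at most the norm and the exponents are
        nonpositive, so the powers of the coordinates are the larger ones.\<close>
      also have "\<dots> \<le> (\<Prod>i=1..Suc m. \<bar>x $ e i\<bar> powr - (\<theta> * (1 - B i)))"
      proof (intro prod_mono conjI)
        fix i assume i: "i \<in> {1..Suc m}"
        have "0 \<le> \<theta> * (1 - B i)" using B[OF i] \<theta> by simp
        then show "?\<rho> powr - (\<theta> * (1 - B i)) \<le> \<bar>x $ e i\<bar> powr - (\<theta> * (1 - B i))"
          using x i by (intro powr_mono2' abs_le_norm_trunc) auto
      qed auto
      finally have "(\<Prod>i=1..Suc m. \<bar>x $ e i\<bar> powr - B i) * ?\<rho> powr (\<kappa> + \<tau> (Suc m)) \<le>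
        (\<Prod>i=1..Suc m. \<bar>x $ e i\<bar> powr - B i) * (\<Prod>i=1..Suc m. \<bar>x $ e i\<bar> powr - (\<theta> * (1 - B i)))"
        by (intro mult_left_mono prod_nonneg) auto
      also have "\<dots> = (\<Prod>i=1..Suc m. \<bar>x $ e i\<bar> powr - B' i)"
        unfolding prod.distrib[symmetric] B'_def by (simp only: powr_add[symmetric] minus_add_distrib)
      also have "\<dots> = \<dots> * ?\<rho> powr 0" using \<rho> by simp
      finally show ?thesis using step[OF x] by linarith
    qed
    ultimately show ?thesis using B'
      by (intro exI[of _ B'] exI[of _ 0]) (auto simp del: sum.cl_ivl_Suc prod.cl_ivl_Suc)
  qed
qed

text \<open>On the cube the weight is dominated by a constant times a product of one-variable
  functions \<open>|x_i|^(-A)\<close> with \<open>A < 1\<close>, whose integral factorises.\<close>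

lemma nn_integral_weight_finite:
  fixes e :: "nat \<Rightarrow> 'n::finite" and \<tau> :: "nat \<Rightarrow> real"
  assumes e: "bij_betw e {1..CARD('n)} UNIV"
    and \<tau>: "\<And>l. l \<in> {2..CARD('n)} \<Longrightarrow> - real l < (\<Sum>j=2..l. \<tau> j)"
  shows "(\<integral>\<^sup>+x. ennreal (weight e \<tau> 2 x) * indicator {x. \<forall>i. \<bar>x $ i\<bar> \<le> R} x \<partial>lborel) < \<infinity>"
proof -
  let ?n = "CARD('n)"
  have "1 \<le> ?n" by (simp add: Suc_le_eq)
  from prod_norm_trunc_le[of ?n \<tau> e, OF this \<tau>] obtain A \<kappa> where \<kappa>: "0 \<le> \<kappa>" and A: "\<And>i. i \<in> {1..?n} \<Longrightarrow> 0 \<le> A i \<and> A i < 1"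
    and le: "\<And>x :: real ^ 'n. (\<forall>i. x $ i \<noteq> 0) \<Longrightarrow>
      weight e \<tau> 2 x \<le> (\<Prod>i=1..?n. \<bar>x $ e i\<bar> powr - A i) * norm (trunc e ?n x) powr \<kappa>"
    unfolding weight_def by blast
  define f where "f = inv_into {1..?n} e"
  have f: "f i \<in> {1..?n}" "f (e j) = j" if "j \<in> {1..?n}" for i j
    using e that bij_betw_inv_into[OF e] by (auto simp: f_def bij_betw_def inv_into_f_f)
  \<comment> \<open>On the cube \<open>|X_n|\<close> is at most the sum of the \<open>|x_i|\<close>,
    hence at most \<open>n * |R|\<close>; \<open>K\<close> bounds the surplus power that was carried
    along.\<close>
  define K where "K = (real ?n * \<bar>R\<bar>) powr \<kappa>"
  let ?h = "\<lambda>i t. ennreal (\<bar>t\<bar> powr - A (f i)) * indicator {-R..R} t"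
  have "(\<integral>\<^sup>+x. ennreal (weight e \<tau> 2 x) * indicator {x. \<forall>i. \<bar>x $ i\<bar> \<le> R} x \<partial>lborel) \<le>
    (\<integral>\<^sup>+x. ennreal K * (\<Prod>i\<in>UNIV. ?h i (x $ i)) \<partial>lborel)"
  proof (rule nn_integral_mono_AE, use AE_lborel_nonzero in eventually_elim)
    fix x :: "real ^ 'n"
    assume x: "\<forall>i. x $ i \<noteq> 0"
    show "ennreal (weight e \<tau> 2 x) * indicator {x. \<forall>i. \<bar>x $ i\<bar> \<le> R} x \<le> ennreal K * (\<Prod>i\<in>UNIV. ?h i (x $ i))"
    proof (cases "\<forall>i. \<bar>x $ i\<bar> \<le> R")
      case True
      have "norm (trunc e ?n x) \<le> (\<Sum>i\<in>UNIV. \<bar>x $ i\<bar>)"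
        using norm_trunc_le[of e ?n x] norm_le_l1_cart[of x] by linarith
      also have "\<dots> \<le> (\<Sum>i\<in>(UNIV::'n set). \<bar>R\<bar>)"
        by (intro sum_mono) (metis True abs_ge_self order_trans)
      finally have "norm (trunc e ?n x) powr \<kappa> \<le> K"
        unfolding K_def using \<kappa> by (intro powr_mono2) auto
      then have "weight e \<tau> 2 x \<le> (\<Prod>i=1..?n. \<bar>x $ e i\<bar> powr - A i) * K"
        using le[OF x] by (meson mult_left_mono order_trans powr_ge_zero prod_nonneg)
      also have "(\<Prod>i=1..?n. \<bar>x $ e i\<bar> powr - A i) = (\<Prod>i=1..?n. \<bar>x $ e i\<bar> powr - A (f (e i)))"
        using f by simp
      also have "\<dots> = (\<Prod>i\<in>UNIV. \<bar>x $ i\<bar> powr - A (f i))"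
        using e by (rule prod.reindex_bij_betw)
      finally have "ennreal (weight e \<tau> 2 x) \<le> ennreal (K * (\<Prod>i\<in>UNIV. \<bar>x $ i\<bar> powr - A (f i)))"
        by (simp add: mult.commute ennreal_leI)
      also have "\<dots> = ennreal K * (\<Prod>i\<in>UNIV. ennreal (\<bar>x $ i\<bar> powr - A (f i)))"
        by (simp add: prod_ennreal K_def ennreal_mult prod_nonneg)
      also have "(\<Prod>i\<in>UNIV. ennreal (\<bar>x $ i\<bar> powr - A (f i))) = (\<Prod>i\<in>UNIV. ?h i (x $ i))"
      proof (intro prod.cong refl)
        fix i
        have "x $ i \<in> {-R..R}" using True by (simp add: abs_le_iff) (metis minus_le_iff)
        then show "ennreal (\<bar>x $ i\<bar> powr - A (f i)) = ?h i (x $ i)" by simp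
      qed
      finally show ?thesis using True by simp
    qed simp
  qed
  also have "\<dots> = ennreal K * (\<Prod>i\<in>UNIV. \<integral>\<^sup>+t. ?h i t \<partial>lborel)"
    by (subst nn_integral_cmult, measurable, subst nn_integral_prod_coordinates[of ?h], measurable)
  also have "\<dots> < \<infinity>"
  proof -
    have "1 \<in> {1..?n}" by (simp add: Suc_le_eq)
    then have "(\<integral>\<^sup>+t. ?h i t \<partial>lborel) < top" for i
      using A[of "f i"] f(1)[of 1 i] nn_integral_abs_powr_finite[of "- A (f i)" R] by simp
    then have "(\<Prod>i\<in>UNIV. \<integral>\<^sup>+t. ?h i t \<partial>lborel) \<noteq> top"
      by (auto simp: ennreal_prod_eq_top less_top)
    then show ?thesis by (simp add: ennreal_mult_less_top less_top)
  qed
  finally show ?thesis .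
qed

section \<open>The weights along lines parallel to the axes\<close>

text \<open>The partial derivative of the weight as its logarithmic derivative times the weight. The
  explicit formula is total and measurable; it is a genuine derivative only along lines that avoid
  \<open>X_2 = 0\<close>.\<close>

definition dweight :: "(nat \<Rightarrow> 'n) \<Rightarrow> (nat \<Rightarrow> real) \<Rightarrow> 'n \<Rightarrow> real ^ 'n::finite \<Rightarrow> real" where
  "dweight e \<sigma> k x = weight e \<sigma> 2 x *
    (\<Sum>j=2..CARD('n). \<sigma> j * (if k \<in> e ` {1..j} then x $ k / (norm (trunc e j x))\<^sup>2 else 0))"

text \<open>The \<open>k\<close>-th component of \<open>V_l\<close>, meant for \<open>k\<close>
  among the first \<open>l\<close> coordinates; the other components of \<open>V_l\<close> are zero,
  which this formula does not encode.\<close>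

definition vfield :: "(nat \<Rightarrow> 'n) \<Rightarrow> (nat \<Rightarrow> real) \<Rightarrow> nat \<Rightarrow> 'n \<Rightarrow> real ^ 'n::finite \<Rightarrow> real" where
  "vfield e \<sigma> l k x = weight e \<sigma> 2 x * (x $ k / norm (trunc e l x))"

text \<open>The derivative of \<open>vfield\<close> in its own direction by the product rule; summed
  over the first \<open>l\<close> coordinates it is the divergence of \<open>V_l\<close>.\<close>

definition dvfield :: "(nat \<Rightarrow> 'n) \<Rightarrow> (nat \<Rightarrow> real) \<Rightarrow> nat \<Rightarrow> 'n \<Rightarrow> real ^ 'n::finite \<Rightarrow> real" where
  "dvfield e \<sigma> l k x = dweight e \<sigma> k x * (x $ k / norm (trunc e l x)) +
    weight e \<sigma> 2 x * (1 / norm (trunc e l x) - (x $ k)\<^sup>2 / norm (trunc e l x) ^ 3)"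

lemma measurable_dweight [measurable]: "dweight e \<sigma> k \<in> borel_measurable borel"
proof -
  have "(\<lambda>x. if k \<in> e ` {1..j} then x $ k / (norm (trunc e j x))\<^sup>2 else 0) \<in> borel_measurable borel" for j
    using measurable_vec_nth[of "\<lambda>x. x" borel] by (cases "k \<in> e ` {1..j}") simp_all
  note [measurable] = this
  show ?thesis unfolding dweight_def[abs_def] by measurable
qed

lemma measurable_vfield [measurable]: "vfield e \<sigma> l k \<in> borel_measurable borel"
  unfolding vfield_def[abs_def] by measurable

lemma measurable_dvfield [measurable]: "dvfield e \<sigma> l k \<in> borel_measurable borel"
  unfolding dvfield_def[abs_def] by measurable

lemma upd_nth_same: "upd k t x $ k = t"
  by simp

lemma sum_upd: "(\<Sum>i\<in>S. (upd k t x $ i)\<^sup>2) = (if k \<in> S then t\<^sup>2 else 0) + (\<Sum>i\<in>S - {k}. (x $ i)\<^sup>2)"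
  if "finite S"
proof (cases "k \<in> S")
  case True
  then show ?thesis using that by (simp add: sum.remove[of S k])
next
  case False
  then have "(\<Sum>i\<in>S. (upd k t x $ i)\<^sup>2) = (\<Sum>i\<in>S. (x $ i)\<^sup>2)"
    by (intro sum.cong) auto
  then show ?thesis using False by simp
qed

lemma norm_trunc_line_derivative:
  assumes "0 < norm (trunc e l (upd k t x))"
  shows "((\<lambda>t. norm (trunc e l (upd k t x))) has_real_derivative
    (if k \<in> e ` {1..l} then t / norm (trunc e l (upd k t x)) else 0)) (at t)"
proof (cases "k \<in> e ` {1..l}")
  case True
  define c where "c = (\<Sum>i\<in>e ` {1..l} - {k}. (x $ i)\<^sup>2)"
  have eq: "norm (trunc e l (upd k t x)) = sqrt (t\<^sup>2 + c)" for t
    unfolding norm_trunc c_def using True by (simp only: sum_upd finite_imageI finite_atLeastAtMost if_True)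
  have p: "0 < t\<^sup>2 + c" using assms unfolding eq by simp
  have "((\<lambda>t. t\<^sup>2 + c) has_real_derivative 2 * t) (at t)"
    by (auto intro!: derivative_eq_intros)
  from DERIV_chain2[OF DERIV_real_sqrt[OF p] this] show ?thesis
    using True by (simp add: eq field_simps)
next
  case False
  have "norm (trunc e l (upd k t x)) = norm (trunc e l x)" for t
    unfolding norm_trunc using False by (simp only: sum_upd finite_imageI finite_atLeastAtMost if_False) simp
  then show ?thesis using False by simp
qed

lemma prod_powr_derivative:
  fixes g :: "'a \<Rightarrow> real \<Rightarrow> real"
  assumes "finite S" and "\<And>j. j \<in> S \<Longrightarrow> 0 < g j t" and "\<And>j. j \<in> S \<Longrightarrow> (g j has_real_derivative g' j) (at t)"
  shows "((\<lambda>t. \<Prod>j\<in>S. g j t powr s j) has_real_derivative (\<Prod>j\<in>S. g j t powr s j) * (\<Sum>j\<in>S. s j * (g' j / g j t))) (at t)"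
  using assms
proof (induction S rule: finite_induct)
  case (insert i S)
  have "((\<lambda>t. g i t powr s i) has_real_derivative s i * g i t powr (s i - 1) * g' i) (at t)"
    using insert.prems by (intro DERIV_chain2[OF has_real_derivative_powr]) auto
  also have "s i * g i t powr (s i - 1) * g' i = g i t powr s i * (s i * (g' i / g i t))"
    using insert.prems(1)[of i] by (simp add: powr_diff field_simps)
  finally have "((\<lambda>t. g i t powr s i * (\<Prod>j\<in>S. g j t powr s j)) has_real_derivative
     g i t powr s i * (s i * (g' i / g i t)) * (\<Prod>j\<in>S. g j t powr s j) +
     (\<Prod>j\<in>S. g j t powr s j) * (\<Sum>j\<in>S. s j * (g' j / g j t)) * g i t powr s i) (at t)"
    using insert by (intro DERIV_mult) auto
  then show ?case
    using insert.hyps by (simp add: algebra_simps)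
qed simp

locale numbering =
  fixes e :: "nat \<Rightarrow> 'n::finite"
  assumes bij: "bij_betw e {1..CARD('n)} UNIV" and card_ge_2: "2 \<le> CARD('n)"
begin

lemma e_inj: "i \<in> {1..CARD('n)} \<Longrightarrow> j \<in> {1..CARD('n)} \<Longrightarrow> e i = e j \<Longrightarrow> i = j"
  using bij by (auto simp: bij_betw_def dest: inj_onD)

text \<open>At most one of \<open>e 1\<close> and \<open>e 2\<close> is the moving coordinate
  \<open>k\<close>, and the other stays nonzero on the whole line. So the weights are differentiable
  at every \<open>t\<close>, also at \<open>t = 0\<close>.\<close>

lemma norm_trunc_line_pos:
  fixes x :: "real ^ 'n"
  assumes "\<And>j. j \<noteq> k \<Longrightarrow> x $ j \<noteq> 0" and "2 \<le> l"
  shows "0 < norm (trunc e l (upd k t x))"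
proof -
  have "e 1 \<noteq> e 2" using e_inj[of 1 2] card_ge_2 by auto
  define i :: nat where "i = (if e 1 = k then 2 else 1)"
  have "i \<in> {1..2}" "e i \<noteq> k" using \<open>e 1 \<noteq> e 2\<close> by (auto simp: i_def)
  then show ?thesis
    using assms by (intro norm_trunc_pos[of "e i"]) auto
qed

context
  fixes k and x :: "real ^ 'n"
  assumes x: "\<And>j. j \<noteq> k \<Longrightarrow> x $ j \<noteq> 0"
begin

lemma weight_line_derivative:
  "((\<lambda>t. weight e \<sigma> 2 (upd k t x)) has_real_derivative dweight e \<sigma> k (upd k t x)) (at t)"
proof -
  let ?g = "\<lambda>j t. norm (trunc e j (upd k t x))"
  let ?g' = "\<lambda>j. if k \<in> e ` {1..j} then t / ?g j t else 0"
  have "((\<lambda>t. \<Prod>j=2..CARD('n). ?g j t powr \<sigma> j) has_real_derivative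
     (\<Prod>j=2..CARD('n). ?g j t powr \<sigma> j) * (\<Sum>j=2..CARD('n). \<sigma> j * (?g' j / ?g j t))) (at t)"
    by (intro prod_powr_derivative norm_trunc_line_derivative norm_trunc_line_pos x) auto
  also have "(\<Sum>j=2..CARD('n). \<sigma> j * (?g' j / ?g j t)) =
     (\<Sum>j=2..CARD('n). \<sigma> j * (if k \<in> e ` {1..j} then t / (?g j t)\<^sup>2 else 0))"
    by (intro sum.cong) (auto simp: power2_eq_square)
  finally show ?thesis
    by (simp add: weight_def dweight_def cong: if_cong)
qed

lemma continuous_norm_trunc_line:
  assumes "2 \<le> l"
  shows "continuous_on UNIV (\<lambda>t. norm (trunc e l (upd k t x)))"
  by (rule DERIV_continuous_on, rule norm_trunc_line_derivative, rule norm_trunc_line_pos) (use x assms in auto)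

lemma continuous_weight_line: "continuous_on UNIV (\<lambda>t. weight e \<sigma> 2 (upd k t x))"
  by (rule DERIV_continuous_on, rule weight_line_derivative)

lemma continuous_dweight_line: "continuous_on UNIV (\<lambda>t. dweight e \<sigma> k (upd k t x))"
proof -
  have c: "continuous_on UNIV (\<lambda>t. if k \<in> e ` {1..j} then t / (norm (trunc e j (upd k t x)))\<^sup>2 else 0)"
    if "j \<in> {2..CARD('n)}" for j
  proof -
    have "norm (trunc e j (upd k t x)) \<noteq> 0" for t
      using norm_trunc_line_pos[of k x j t] x that by force
    then have "continuous_on UNIV (\<lambda>t. t / (norm (trunc e j (upd k t x)))\<^sup>2)"
      using that
      by (intro continuous_on_divide continuous_on_power continuous_on_id continuous_norm_trunc_line) auto
    then show ?thesis by (cases "k \<in> e ` {1..j}") (simp_all only: if_True if_False continuous_on_const)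
  qed
  show ?thesis
    unfolding dweight_def upd_nth_same
    by (intro continuous_on_mult continuous_weight_line continuous_on_sum continuous_on_const c) auto
qed

context
  fixes l :: nat
  assumes l: "2 \<le> l"
begin

lemma vfield_line_derivative:
  "((\<lambda>t. vfield e \<sigma> l k (upd k t x)) has_real_derivative dvfield e \<sigma> l k (upd k t x)) (at t)"
  if "k \<in> e ` {1..l}"
proof -
  let ?\<rho> = "\<lambda>t. norm (trunc e l (upd k t x))"
  have p: "0 < ?\<rho> t" using norm_trunc_line_pos x l by blast
  have "((\<lambda>t. t / ?\<rho> t) has_real_derivative 1 / ?\<rho> t - t\<^sup>2 / ?\<rho> t ^ 3) (at t)"
    using DERIV_divide[OF DERIV_ident norm_trunc_line_derivative[OF p]] p that
    by (simp add: field_simps power2_eq_square power3_eq_cube)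
  from DERIV_mult[OF weight_line_derivative this] show ?thesis
    by (simp add: vfield_def dvfield_def algebra_simps)
qed

lemma continuous_dvfield_line: "continuous_on UNIV (\<lambda>t. dvfield e \<sigma> l k (upd k t x))"
proof -
  have p: "norm (trunc e l (upd k t x)) \<noteq> 0" for t using norm_trunc_line_pos[of k x l t] x l by force
  show ?thesis
    unfolding dvfield_def upd_nth_same
    by (intro continuous_intros continuous_weight_line continuous_dweight_line continuous_norm_trunc_line l)
      (use p in auto)
qed

end

end

end

section \<open>Pointwise bounds for the weight, the vector fields and their divergence\<close>

lemma norm_trunc_quotient_le: "\<bar>x $ k\<bar> / norm (trunc e l x) \<le> 1" if "k \<in> e ` {1..l}"
  using abs_le_norm_trunc[OF that, of x] by (simp add: divide_le_eq)

text \<open>By \<open>0 powr a = 0\<close> this holds even if the exponents are negative. Together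
  with division by zero yielding 0 it makes the bounds on \<open>dweight\<close> and
  \<open>dvfield\<close> true at every point, singular ones included.\<close>

lemma weight_eq_0: "weight e \<sigma> 2 x = 0" if "norm (trunc e 2 x) = 0" "2 \<le> CARD('n)"
  for x :: "real ^ 'n::finite"
  using that unfolding weight_def by (intro prod_zero) (auto intro!: bexI[of _ 2])

lemma abs_vfield_le: "\<bar>vfield e \<sigma> l k x\<bar> \<le> weight e \<sigma> 2 x" if "k \<in> e ` {1..l}"
proof -
  have "\<bar>vfield e \<sigma> l k x\<bar> = weight e \<sigma> 2 x * (\<bar>x $ k\<bar> / norm (trunc e l x))"
    by (simp add: vfield_def abs_mult weight_nonneg)
  also have "\<dots> \<le> weight e \<sigma> 2 x * 1"
    by (intro mult_left_mono norm_trunc_quotient_le that weight_nonneg)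
  finally show ?thesis by simp
qed

lemma inverse_norm_trunc_le:
  assumes "0 < norm (trunc e 2 x)" "2 \<le> l"
  shows "1 / norm (trunc e l x) \<le> 1 / norm (trunc e 2 x)"
  using assms norm_trunc_mono[OF assms(2), of e x] by (intro divide_left_mono mult_pos_pos) auto

context numbering
begin

text \<open>Each summand is at most \<open>1 / |X_j|\<close>, since
  \<open>|x_k| \<le> |X_j|\<close>, and \<open>|X_2| \<le> |X_j|\<close>.\<close>

lemma abs_dweight_le:
  "\<bar>dweight e \<sigma> k x\<bar> \<le> (\<Sum>j=2..CARD('n). \<bar>\<sigma> j\<bar>) * (weight e \<sigma> 2 x / norm (trunc e 2 x))"
proof (cases "norm (trunc e 2 x) = 0")
  case True
  then show ?thesis using weight_eq_0[OF True card_ge_2] by (simp add: dweight_def)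
next
  case False
  then have p: "0 < norm (trunc e 2 x)" by simp
  have "\<bar>dweight e \<sigma> k x\<bar> = weight e \<sigma> 2 x *
    \<bar>\<Sum>j=2..CARD('n). \<sigma> j * (if k \<in> e ` {1..j} then x $ k / (norm (trunc e j x))\<^sup>2 else 0)\<bar>"
    by (simp add: dweight_def abs_mult weight_nonneg)
  also have "\<dots> \<le> weight e \<sigma> 2 x * (\<Sum>j=2..CARD('n). \<bar>\<sigma> j\<bar> * (1 / norm (trunc e 2 x)))"
  proof (intro mult_left_mono weight_nonneg order_trans[OF sum_abs] sum_mono)
    fix j assume j: "j \<in> {2..CARD('n)}"
    let ?r = "norm (trunc e j x)"
    have r: "0 < ?r" using p norm_trunc_mono[of 2 j e x] j by auto
    have "\<bar>if k \<in> e ` {1..j} then x $ k / ?r\<^sup>2 else 0\<bar> \<le> 1 / norm (trunc e 2 x)"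
    proof (cases "k \<in> e ` {1..j}")
      case True
      then have "\<bar>if k \<in> e ` {1..j} then x $ k / ?r\<^sup>2 else 0\<bar> = \<bar>x $ k\<bar> / ?r * (1 / ?r)"
        by (simp add: power2_eq_square)
      also have "\<dots> \<le> 1 * (1 / norm (trunc e 2 x))"
        using j p True by (intro mult_mono norm_trunc_quotient_le inverse_norm_trunc_le) auto
      finally show ?thesis by simp
    qed simp
    then show "\<bar>\<sigma> j * (if k \<in> e ` {1..j} then x $ k / ?r\<^sup>2 else 0)\<bar> \<le> \<bar>\<sigma> j\<bar> * (1 / norm (trunc e 2 x))"
      unfolding abs_mult by (intro mult_left_mono) auto
  qed
  finally show ?thesis by (simp add: sum_distrib_right sum_distrib_left mult_ac flip: sum_divide_distrib)
qed

text \<open>The 2 stems from the derivative of \<open>x_k / |X_l|\<close>: both of its terms are at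
  most \<open>1 / |X_l|\<close>. The bound serves integrability only, so its size is
  immaterial.\<close>

lemma abs_dvfield_le:
  assumes k: "k \<in> e ` {1..l}" and l: "2 \<le> l"
  shows "\<bar>dvfield e \<sigma> l k x\<bar> \<le> ((\<Sum>j=2..CARD('n). \<bar>\<sigma> j\<bar>) + 2) * (weight e \<sigma> 2 x / norm (trunc e 2 x))"
proof (cases "norm (trunc e 2 x) = 0")
  case True
  then show ?thesis using weight_eq_0[OF True card_ge_2] by (simp add: dvfield_def dweight_def)
next
  case False
  let ?r = "norm (trunc e l x)"
  from False have p: "0 < norm (trunc e 2 x)" by simp
  have r: "0 < ?r" using p norm_trunc_mono[OF l, of e x] by linarith
  have q: "\<bar>x $ k\<bar> / ?r \<le> 1" by (rule norm_trunc_quotient_le[OF k])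
  have "(x $ k)\<^sup>2 / ?r ^ 3 = (\<bar>x $ k\<bar> / ?r)\<^sup>2 * (1 / ?r)"
    by (simp add: power_divide power3_eq_cube power2_eq_square)
  moreover have "\<dots> \<le> 1 * (1 / ?r)"
    using q by (intro mult_right_mono power_le_one) auto
  ultimately have "(x $ k)\<^sup>2 / ?r ^ 3 \<le> 1 / ?r" by simp
  moreover have "0 \<le> (x $ k)\<^sup>2 / ?r ^ 3" "0 < 1 / ?r" using r by simp_all
  ultimately have "\<bar>1 / ?r - (x $ k)\<^sup>2 / ?r ^ 3\<bar> \<le> 2 * (1 / ?r)"
    by linarith
  also have "\<dots> \<le> 2 * (1 / norm (trunc e 2 x))"
    using inverse_norm_trunc_le[OF p l] by simp
  finally have "weight e \<sigma> 2 x * \<bar>1 / ?r - (x $ k)\<^sup>2 / ?r ^ 3\<bar> \<le> weight e \<sigma> 2 x * (2 * (1 / norm (trunc e 2 x)))"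
    by (intro mult_left_mono weight_nonneg)
  moreover have "\<bar>dweight e \<sigma> k x\<bar> * (\<bar>x $ k\<bar> / ?r) \<le> \<bar>dweight e \<sigma> k x\<bar> * 1"
    by (intro mult_left_mono q) auto
  moreover note abs_dweight_le[of \<sigma> k x]
  moreover have "\<bar>dvfield e \<sigma> l k x\<bar> \<le> \<bar>dweight e \<sigma> k x\<bar> * (\<bar>x $ k\<bar> / ?r) +
     weight e \<sigma> 2 x * \<bar>1 / ?r - (x $ k)\<^sup>2 / ?r ^ 3\<bar>"
    unfolding dvfield_def by (rule order_trans[OF abs_triangle_ineq]) (simp add: abs_mult weight_nonneg)
  moreover have "weight e \<sigma> 2 x * (2 * (1 / norm (trunc e 2 x))) = 2 * (weight e \<sigma> 2 x / norm (trunc e 2 x))"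
    by simp
  ultimately show ?thesis unfolding distrib_right by linarith
qed

lemma card_e: "l \<le> CARD('n) \<Longrightarrow> card (e ` {1..l}) = l"
  using bij by (subst card_image) (auto simp: bij_betw_def intro: inj_on_subset)

text \<open>The terms with \<open>j \<le> l\<close> contribute \<open>\<sigma> j\<close> exactly,
  and \<open>X_l / |X_l|\<close> itself contributes \<open>l - 1\<close>. A term with
  \<open>j > l\<close> carries the factor \<open>|X_l| / |X_j|^2 \<le> 1 / |X_j|\<close> and is
  estimated by its absolute value, its sign being unknown.\<close>

lemma divergence_vfield_ge:
  assumes p: "0 < norm (trunc e 2 x)" and l: "2 \<le> l" "l \<le> CARD('n)"
  shows "((\<Sum>j=2..l. \<sigma> j) + real l - 1) * (weight e \<sigma> 2 x / norm (trunc e l x))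
      - (\<Sum>j=Suc l..CARD('n). \<bar>\<sigma> j\<bar> * (weight e \<sigma> 2 x / norm (trunc e j x)))
    \<le> (\<Sum>k\<in>e ` {1..l}. dvfield e \<sigma> l k x)"
proof -
  let ?r = "\<lambda>l. norm (trunc e l x)" and ?W = "weight e \<sigma> 2 x" and ?I = "\<lambda>l. e ` {1..l}"
  have r: "0 < ?r j" if "2 \<le> j" for j using p norm_trunc_mono[OF that, of e x] by linarith
  have sq: "(?r j)\<^sup>2 = (\<Sum>i\<in>?I j. (x $ i)\<^sup>2)" for j
    by (simp add: norm_trunc sum_nonneg)
  have I: "?I l \<inter> ?I j = ?I (min l j)" for j
    by (cases "l \<le> j") (force simp: min_def)+
  \<comment> \<open>The numerator is the scalar product of \<open>X_j\<close> and
    \<open>X_l\<close>, which agree on the first \<open>min l j\<close> coordinates while one of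
    them vanishes beyond.\<close>
  have A: "(\<Sum>k\<in>?I l. (if k \<in> ?I j then x $ k / (?r j)\<^sup>2 else 0) * (x $ k / ?r l)) = (?r (min l j))\<^sup>2 / (?r j)\<^sup>2 / ?r l" for j
  proof -
    have "(\<Sum>k\<in>?I l. (if k \<in> ?I j then x $ k / (?r j)\<^sup>2 else 0) * (x $ k / ?r l))
      = (\<Sum>k\<in>?I l. if k \<in> ?I j then (x $ k)\<^sup>2 / (?r j)\<^sup>2 / ?r l else 0)"
      by (intro sum.cong refl) (auto simp: power2_eq_square)
    also have "\<dots> = (\<Sum>k\<in>?I l \<inter> ?I j. (x $ k)\<^sup>2 / (?r j)\<^sup>2 / ?r l)"
      by (rule sum.inter_restrict[symmetric]) simp
    also have "\<dots> = (?r (min l j))\<^sup>2 / (?r j)\<^sup>2 / ?r l"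
      unfolding I sq[of "min l j"] by (simp only: sum_divide_distrib)
    finally show ?thesis .
  qed
  have "(\<Sum>k\<in>?I l. dweight e \<sigma> k x * (x $ k / ?r l)) =
     (\<Sum>k\<in>?I l. \<Sum>j=2..CARD('n). ?W * \<sigma> j * ((if k \<in> ?I j then x $ k / (?r j)\<^sup>2 else 0) * (x $ k / ?r l)))"
    unfolding dweight_def by (simp only: sum_distrib_left sum_distrib_right mult.assoc)
  also have "\<dots> = (\<Sum>j=2..CARD('n). ?W * \<sigma> j * ((?r (min l j))\<^sup>2 / (?r j)\<^sup>2 / ?r l))"
    unfolding A[symmetric] sum_distrib_left by (rule sum.swap)
  also have "\<dots> = (\<Sum>j=2..l. ?W * \<sigma> j * ((?r (min l j))\<^sup>2 / (?r j)\<^sup>2 / ?r l)) +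
      (\<Sum>j=Suc l..CARD('n). ?W * \<sigma> j * ((?r (min l j))\<^sup>2 / (?r j)\<^sup>2 / ?r l))"
    using l by (subst sum.union_disjoint[symmetric]) (auto intro!: sum.cong)
  also have "(\<Sum>j=2..l. ?W * \<sigma> j * ((?r (min l j))\<^sup>2 / (?r j)\<^sup>2 / ?r l)) = (\<Sum>j=2..l. \<sigma> j * (?W / ?r l))"
  proof (intro sum.cong refl)
    fix j assume j: "j \<in> {2..l}"
    then have "min l j = j" by simp
    with j show "?W * \<sigma> j * ((?r (min l j))\<^sup>2 / (?r j)\<^sup>2 / ?r l) = \<sigma> j * (?W / ?r l)"
      using r[of j] by simp
  qed
  also have "(\<Sum>j=2..l. \<sigma> j * (?W / ?r l)) = (\<Sum>j=2..l. \<sigma> j) * (?W / ?r l)"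
    by (rule sum_distrib_right[symmetric])
  finally have 1: "(\<Sum>k\<in>?I l. dweight e \<sigma> k x * (x $ k / ?r l)) = (\<Sum>j=2..l. \<sigma> j) * (?W / ?r l) +
      (\<Sum>j=Suc l..CARD('n). ?W * \<sigma> j * ((?r (min l j))\<^sup>2 / (?r j)\<^sup>2 / ?r l))" .
  \<comment> \<open>The divergence \<open>(l - 1) / r\<close> of the unit radial field in dimension
    \<open>l\<close>.\<close>
  have "(\<Sum>k\<in>?I l. 1 / ?r l - (x $ k)\<^sup>2 / ?r l ^ 3) = real l / ?r l - (?r l)\<^sup>2 / ?r l ^ 3"
    unfolding sum_subtractf sq using card_e[OF l(2)] by (simp add: sum_divide_distrib)
  also have "(?r l)\<^sup>2 / ?r l ^ 3 = 1 / ?r l"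
    using r[OF l(1)] by (simp add: power2_eq_square power3_eq_cube)
  finally have s: "(\<Sum>k\<in>?I l. 1 / ?r l - (x $ k)\<^sup>2 / ?r l ^ 3) = real l / ?r l - 1 / ?r l" .
  have 2: "(\<Sum>k\<in>?I l. ?W * (1 / ?r l - (x $ k)\<^sup>2 / ?r l ^ 3)) = (real l - 1) * (?W / ?r l)"
    unfolding sum_distrib_left[symmetric] s by (simp add: algebra_simps diff_divide_distrib)
  have 3: "- (\<Sum>j=Suc l..CARD('n). \<bar>\<sigma> j\<bar> * (?W / ?r j)) \<le>
     (\<Sum>j=Suc l..CARD('n). ?W * \<sigma> j * ((?r (min l j))\<^sup>2 / (?r j)\<^sup>2 / ?r l))"
    unfolding sum_negf[symmetric]
  proof (rule sum_mono)
    fix j assume j: "j \<in> {Suc l..CARD('n)}"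
    have rj: "0 < ?r j" "0 < ?r l" "?r l \<le> ?r j"
      using r[of j] r[of l] norm_trunc_mono[of l j e x] j l by (simp_all del: zero_less_norm_iff)
    have "(?r (min l j))\<^sup>2 / (?r j)\<^sup>2 / ?r l = ?r l / ?r j * (1 / ?r j)"
      using j rj by (simp add: min_def power2_eq_square)
    also have "\<dots> \<le> 1 * (1 / ?r j)" using rj by (intro mult_right_mono) (auto simp: divide_le_eq)
    finally have "?W * \<bar>\<sigma> j\<bar> * ((?r (min l j))\<^sup>2 / (?r j)\<^sup>2 / ?r l) \<le> ?W * \<bar>\<sigma> j\<bar> * (1 / ?r j)"
      by (intro mult_left_mono mult_nonneg_nonneg weight_nonneg) auto
    moreover have "\<bar>?W * \<sigma> j * ((?r (min l j))\<^sup>2 / (?r j)\<^sup>2 / ?r l)\<bar> = ?W * \<bar>\<sigma> j\<bar> * ((?r (min l j))\<^sup>2 / (?r j)\<^sup>2 / ?r l)"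
      by (simp add: abs_mult weight_nonneg)
    moreover have "?W * \<bar>\<sigma> j\<bar> * (1 / ?r j) = \<bar>\<sigma> j\<bar> * (?W / ?r j)" by simp
    ultimately show "- (\<bar>\<sigma> j\<bar> * (?W / ?r j)) \<le> ?W * \<sigma> j * ((?r (min l j))\<^sup>2 / (?r j)\<^sup>2 / ?r l)"
      by linarith
  qed
  have "(\<Sum>k\<in>?I l. dvfield e \<sigma> l k x) = (\<Sum>j=2..l. \<sigma> j) * (?W / ?r l) +
      (\<Sum>j=Suc l..CARD('n). ?W * \<sigma> j * ((?r (min l j))\<^sup>2 / (?r j)\<^sup>2 / ?r l)) + (real l - 1) * (?W / ?r l)"
    unfolding dvfield_def sum.distrib 1 2 ..
  then show ?thesis using 3 unfolding distrib_right left_diff_distrib mult_1 by linarith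
qed

end

section \<open>Test functions: derivatives along lines, support and bounds\<close>

lemma upd_has_derivative: "((\<lambda>t. upd k t x) has_derivative (\<lambda>h. h *\<^sub>R axis k 1)) (at t)"
proof -
  have eq: "(\<lambda>t. upd k t x) = (\<lambda>t. upd k 0 x + t *\<^sub>R axis k 1)"
    by (auto simp: fun_eq_iff vec_eq_iff axis_def)
  show ?thesis by (subst eq) (auto intro!: derivative_eq_intros)
qed

lemma continuous_upd: "continuous_on UNIV (\<lambda>t. upd k t x)"
  by (rule has_derivative_continuous_on, rule has_derivative_at_withinI, rule upd_has_derivative)

context
  fixes w :: "real ^ 'n::finite \<Rightarrow> real"
  assumes w: "w \<in> test_functions"
begin

lemma test_function_continuous: "continuous_on UNIV w" "continuous_on UNIV (partial_deriv k w)"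
proof -
  have C: "C_diff m w" for m using w by (simp add: test_functions_def)
  show "continuous_on UNIV w" using C[of 0] by simp
  show "continuous_on UNIV (partial_deriv k w)" using C[of 1] by simp
qed

lemma test_function_measurable [measurable]:
  "w \<in> borel_measurable borel" "partial_deriv k w \<in> borel_measurable borel"
  "grad w \<in> borel_measurable borel"
proof -
  show "w \<in> borel_measurable borel" "partial_deriv k w \<in> borel_measurable borel" for k
    by (auto intro!: borel_measurable_continuous_onI test_function_continuous)
  then show "grad w \<in> borel_measurable borel"
    unfolding grad_def[abs_def] by (intro measurable_vec_lambda) auto
qed

lemma test_function_has_derivative: "(w has_derivative frechet_derivative w (at y)) (at y)"
proof -
  have "C_diff (Suc 0) w" using w by (simp add: test_functions_def)
  then show ?thesis using frechet_derivative_works by (simp only: C_diff.simps) blast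
qed

lemma test_function_line_derivative:
  "((\<lambda>t. w (upd k t x)) has_real_derivative partial_deriv k w (upd k t x)) (at t)"
proof -
  let ?F = "frechet_derivative w (at (upd k t x))"
  have "((\<lambda>t. w (upd k t x)) has_derivative (\<lambda>h. ?F (h *\<^sub>R axis k 1))) (at t)"
    using diff_chain_at[OF upd_has_derivative test_function_has_derivative] by (simp add: o_def)
  moreover have "?F (h *\<^sub>R axis k 1) = partial_deriv k w (upd k t x) * h" for h
    using linear_scale[OF has_derivative_linear[OF test_function_has_derivative]]
    by (simp add: partial_deriv_def)
  ultimately show ?thesis by (simp add: has_field_derivative_def)
qed

lemma abs_partial_deriv_le: "\<bar>partial_deriv k w x\<bar> \<le> norm (grad w x)"
  using component_le_norm_cart[of "grad w x" k] by (simp add: grad_def)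

text \<open>The complement of the closed support is open, so the derivatives vanish there too.
  Adding 1 to the bound puts also the points with \<open>|x_i| = R\<close> outside the closed
  support.\<close>

lemma test_function_support:
  obtains R where "0 \<le> R" "\<And>x i. R \<le> \<bar>x $ i\<bar> \<Longrightarrow> w x = 0" "\<And>x i k. R \<le> \<bar>x $ i\<bar> \<Longrightarrow> partial_deriv k w x = 0"
proof -
  let ?S = "closure {x. w x \<noteq> 0}"
  have "bounded ?S" using w by (simp add: test_functions_def compact_imp_bounded)
  then obtain B where B: "\<And>x. x \<in> ?S \<Longrightarrow> norm x \<le> B" unfolding bounded_iff by blast
  have out: "x \<notin> ?S" if "\<bar>B\<bar> + 1 \<le> \<bar>x $ i\<bar>" for x i
  proof
    assume "x \<in> ?S"
    from B[OF this] component_le_norm_cart[of x i] that show False by linarith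
  qed
  have z: "w x = 0" if "x \<notin> ?S" for x
  proof (rule ccontr)
    assume "w x \<noteq> 0"
    then have "x \<in> ?S" by (intro subsetD[OF closure_subset]) simp
    with that show False ..
  qed
  have "partial_deriv k w x = 0" if "x \<notin> ?S" for x k
  proof -
    have "(w has_derivative (\<lambda>_. 0)) (at x)"
    proof (rule has_derivative_transform_within_open)
      show "((\<lambda>_. 0) has_derivative (\<lambda>_. 0)) (at x)" by (rule has_derivative_const)
      show "open (- ?S)" by (simp add: open_Compl)
      show "x \<in> - ?S" unfolding Compl_iff by (rule that)
      show "0 = w y" if "y \<in> - ?S" for y using z[OF ComplD[OF that]] by (rule sym)
    qed
    then have "frechet_derivative w (at x) = (\<lambda>_. 0)"
      by (rule frechet_derivative_at[symmetric])
    then show ?thesis by (simp add: partial_deriv_def)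
  qed
  with out z show thesis by (intro that[of "\<bar>B\<bar> + 1"]) (linarith | blast)+
qed

lemma test_function_bounded:
  obtains M where "\<And>x. \<bar>w x\<bar> \<le> M" "\<And>x. norm (grad w x) \<le> M"
proof -
  obtain R where R: "0 \<le> R" "\<And>x i. R \<le> \<bar>x $ i\<bar> \<Longrightarrow> w x = 0" "\<And>x i k. R \<le> \<bar>x $ i\<bar> \<Longrightarrow> partial_deriv k w x = 0"
    by (rule test_function_support) blast
  let ?K = "cbox (\<chi> i. - R) (\<chi> i. R) :: (real ^ 'n) set"
  have K: "x \<in> ?K" if "\<And>i. \<not> R \<le> \<bar>x $ i\<bar>" for x :: "real ^ 'n"
  proof -
    have "- R \<le> x $ i \<and> x $ i \<le> R" for i using that[of i] by linarith
    then show ?thesis by (simp add: mem_box_cart)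
  qed
  have bd: "\<exists>M. \<forall>x. \<bar>f x\<bar> \<le> M" if f: "continuous_on UNIV f" "\<And>x i. R \<le> \<bar>x $ i\<bar> \<Longrightarrow> f x = 0" for f :: "real ^ 'n \<Rightarrow> real"
  proof -
    have "bounded (f ` ?K)"
      by (intro compact_imp_bounded compact_continuous_image continuous_on_subset[OF f(1)]) auto
    then obtain M where M: "\<And>x. x \<in> ?K \<Longrightarrow> \<bar>f x\<bar> \<le> M" by (auto simp: bounded_iff)
    have "\<bar>f x\<bar> \<le> \<bar>M\<bar>" for x
    proof (cases "\<exists>i. R \<le> \<bar>x $ i\<bar>")
      case False
      then have "\<bar>f x\<bar> \<le> M" using M[OF K[of x]] by blast
      then show ?thesis by linarith
    qed (use f(2) in auto)
    then show ?thesis by blast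
  qed
  obtain M0 where M0: "\<And>x. \<bar>w x\<bar> \<le> M0" using bd[of w] test_function_continuous(1) R(2) by metis
  have "\<forall>k. \<exists>M. \<forall>x. \<bar>partial_deriv k w x\<bar> \<le> M"
  proof
    fix k
    show "\<exists>M. \<forall>x. \<bar>partial_deriv k w x\<bar> \<le> M"
      by (rule bd) (use test_function_continuous(2) R(3) in blast)+
  qed
  then obtain M where M: "\<And>k x. \<bar>partial_deriv k w x\<bar> \<le> M k" by metis
  have "norm (grad w x) \<le> (\<Sum>k\<in>UNIV. M k)" for x
  proof (rule order_trans[OF norm_le_l1_cart], rule sum_mono)
    show "\<bar>grad w x $ k\<bar> \<le> M k" for k using M[of k x] by (simp add: grad_def)
  qed
  with M0 show thesis
    by (intro that[of "max M0 (\<Sum>k\<in>UNIV. M k)"]) (auto simp: le_max_iff_disj)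
qed

end

section \<open>The Hardy inequality\<close>

locale weights = numbering e for e :: "nat \<Rightarrow> 'n::finite" +
  fixes \<sigma> :: "nat \<Rightarrow> real"
  assumes c_pos: "\<And>l. l \<in> {2..CARD('n)} \<Longrightarrow> 0 < (\<Sum>j=2..l. \<sigma> j) + real l - 1"
begin

abbreviation "W \<equiv> weight e \<sigma> 2"
abbreviation "\<rho> l x \<equiv> norm (trunc e l x)"

definition energy :: "(real ^ 'n \<Rightarrow> real) \<Rightarrow> real" where
  "energy w = (LINT x|lborel. W x * norm (grad w x))"

text \<open>Dividing by \<open>|X_2|\<close> only lowers \<open>\<sigma> 2\<close> by 1, so the
  integrability result for weights covers the quotient.\<close>

lemma weight_div: "W x / \<rho> 2 x = weight e (\<sigma>(2 := \<sigma> 2 - 1)) 2 x"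
proof (cases "\<rho> 2 x = 0")
  case True
  then show ?thesis using weight_eq_0[OF True card_ge_2] by (simp add: weight_def)
next
  case False
  have "{2..CARD('n)} = insert 2 {3..CARD('n)}" using card_ge_2 by auto
  then have eq: "weight e \<tau> 2 x = \<rho> 2 x powr \<tau> 2 * (\<Prod>l=3..CARD('n). \<rho> l x powr \<tau> l)" for \<tau>
    by (simp add: weight_def)
  have "(\<Prod>l=3..CARD('n). \<rho> l x powr (\<sigma>(2 := \<sigma> 2 - 1)) l) = (\<Prod>l=3..CARD('n). \<rho> l x powr \<sigma> l)"
    by (intro prod.cong) auto
  then show ?thesis using False by (simp add: eq powr_diff)
qed

lemma integrable_if_le:
  fixes g :: "real ^ 'n \<Rightarrow> real"
  assumes [measurable]: "g \<in> borel_measurable borel"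
    and le: "\<And>x. \<bar>g x\<bar> \<le> K * (W x / \<rho> 2 x)" and z: "\<And>x i. R < \<bar>x $ i\<bar> \<Longrightarrow> g x = 0"
  shows "integrable lborel g"
proof (rule integrableI_bounded)
  let ?\<tau> = "\<sigma>(2 := \<sigma> 2 - 1)"
  let ?I = "indicator {x :: real ^ 'n. \<forall>i. \<bar>x $ i\<bar> \<le> R} :: _ \<Rightarrow> ennreal"
  \<comment> \<open>With \<open>\<sigma> 2\<close> lowered by 1 the partial sum is
    \<open>c_l - l\<close>, so the integrability condition is just \<open>c_l > 0\<close>.\<close>
  have sum: "- real l < (\<Sum>j=2..l. ?\<tau> j)" if "l \<in> {2..CARD('n)}" for l
  proof -
    have "{2..l} = insert 2 {3..l}" using that by auto
    moreover have "(\<Sum>j=3..l. ?\<tau> j) = (\<Sum>j=3..l. \<sigma> j)" by (intro sum.cong) auto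
    ultimately have "(\<Sum>j=2..l. ?\<tau> j) = (\<Sum>j=2..l. \<sigma> j) - 1" by simp
    then show ?thesis using c_pos[OF that] by simp
  qed
  have "(\<integral>\<^sup>+x. ennreal (norm (g x)) \<partial>lborel) \<le> (\<integral>\<^sup>+x. ennreal K * (ennreal (weight e ?\<tau> 2 x) * ?I x) \<partial>lborel)"
  proof (rule nn_integral_mono)
    fix x
    show "ennreal (norm (g x)) \<le> ennreal K * (ennreal (weight e ?\<tau> 2 x) * ?I x)"
    proof (cases "\<exists>i. R < \<bar>x $ i\<bar>")
      case True
      then show ?thesis using z by auto
    next
      case False
      then have "?I x = 1" by (auto simp: not_less)
      moreover have "ennreal (norm (g x)) \<le> ennreal (K * weight e ?\<tau> 2 x)"
        using le[of x] unfolding weight_div by (simp add: ennreal_leI)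
      ultimately show ?thesis by (simp add: ennreal_mult'' weight_nonneg)
    qed
  qed
  also have "\<dots> \<le> ennreal K * (\<integral>\<^sup>+x. ennreal (weight e ?\<tau> 2 x) * ?I x \<partial>lborel)"
  proof -
    have "{x :: real ^ 'n. \<forall>i. \<bar>x $ i\<bar> \<le> R} = (\<Inter>i. {x. \<bar>x $ i\<bar> \<le> R})" by auto
    also have "\<dots> \<in> sets borel" by (intro sets.finite_INT) auto
    finally show ?thesis by (subst nn_integral_cmult) auto
  qed
  also have "\<dots> < \<infinity>"
    using nn_integral_weight_finite[OF bij, of ?\<tau> R, OF sum] by (simp add: ennreal_mult_less_top)
  finally show "(\<integral>\<^sup>+x. ennreal (norm (g x)) \<partial>lborel) < \<infinity>" .
qed simp

lemma weight_div_le: "W x / \<rho> l x \<le> W x / \<rho> 2 x" if "2 \<le> l"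
proof (cases "\<rho> 2 x = 0")
  case True
  then show ?thesis using weight_eq_0[OF True card_ge_2] by simp
next
  case False
  then have "0 < \<rho> 2 x" by simp
  from mult_left_mono[OF inverse_norm_trunc_le[OF this that] weight_nonneg[of e \<sigma> 2 x]] show ?thesis
    by simp
qed

context
  fixes w :: "real ^ 'n \<Rightarrow> real"
  assumes w: "w \<in> test_functions"
begin

lemmas [measurable] = test_function_measurable[OF w]

text \<open>On the cube containing the support, \<open>|X_2| \<le> n * R\<close>, so
  \<open>W\<close> is at most \<open>n * R\<close> times \<open>W / |X_2|\<close>.\<close>

lemma integrable_energy: "integrable lborel (\<lambda>x. W x * norm (grad w x))"
proof -
  obtain R where R: "0 \<le> R" "\<And>x i k. R \<le> \<bar>x $ i\<bar> \<Longrightarrow> partial_deriv k w x = 0"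
    by (rule test_function_support[OF w]) blast
  obtain M where M: "\<And>x. norm (grad w x) \<le> M"
    by (rule test_function_bounded[OF w]) blast
  have M0: "0 \<le> M" using M[of 0] norm_ge_zero[of "grad w 0"] by linarith
  have z: "grad w x = 0" if "R < \<bar>x $ i\<bar>" for x i
    using R(2)[of x i] that by (simp add: grad_def vec_eq_iff)
  show ?thesis
  proof (rule integrable_if_le)
    show "(\<lambda>x. W x * norm (grad w x)) \<in> borel_measurable borel" by measurable
    show "W x * norm (grad w x) = 0" if "R < \<bar>x $ i\<bar>" for x i using z[OF that] by simp
    fix x
    show "\<bar>W x * norm (grad w x)\<bar> \<le> (CARD('n) * R * M) * (W x / \<rho> 2 x)"
    proof (cases "\<exists>i. R < \<bar>x $ i\<bar>")
      case True
      then show ?thesis using z R(1) M0 by (auto intro!: mult_nonneg_nonneg divide_nonneg_nonneg weight_nonneg)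
    next
      case False
      have "\<rho> 2 x \<le> (\<Sum>i\<in>UNIV. \<bar>x $ i\<bar>)"
        using norm_trunc_le[of e 2 x] norm_le_l1_cart[of x] by linarith
      also have "\<dots> \<le> (\<Sum>i\<in>(UNIV::'n set). R)" using False by (intro sum_mono) (simp add: not_less)
      finally have "\<rho> 2 x \<le> CARD('n) * R" by simp
      then have "(W x / \<rho> 2 x) * \<rho> 2 x * norm (grad w x) \<le> (W x / \<rho> 2 x) * (CARD('n) * R) * M"
        using R(1) by (intro mult_mono M) (auto intro!: mult_nonneg_nonneg divide_nonneg_nonneg weight_nonneg)
      moreover have "(W x / \<rho> 2 x) * \<rho> 2 x = W x"
        using weight_eq_0[of e x \<sigma>] card_ge_2 by (cases "\<rho> 2 x = 0") auto
      ultimately show ?thesis by (simp add: abs_mult weight_nonneg mult_ac)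
    qed
  qed
qed

lemma integrable_times_test_function:
  assumes [measurable]: "g \<in> borel_measurable borel" and g: "\<And>x. \<bar>g x\<bar> \<le> K * (W x / \<rho> 2 x)"
  shows "integrable lborel (\<lambda>x. g x * \<bar>w x\<bar>)"
proof -
  obtain R where R: "0 \<le> R" "\<And>x i. R \<le> \<bar>x $ i\<bar> \<Longrightarrow> w x = 0"
    by (rule test_function_support[OF w]) blast
  obtain M where M: "\<And>x. \<bar>w x\<bar> \<le> M"
    by (rule test_function_bounded[OF w]) blast
  show ?thesis
  proof (rule integrable_if_le)
    show "(\<lambda>x. g x * \<bar>w x\<bar>) \<in> borel_measurable borel" by measurable
    show "g x * \<bar>w x\<bar> = 0" if "R < \<bar>x $ i\<bar>" for x i using R(2)[of x i] that by simp
    fix x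
    have "\<bar>g x * \<bar>w x\<bar>\<bar> = \<bar>g x\<bar> * \<bar>w x\<bar>" by (simp add: abs_mult)
    also have "\<dots> \<le> (K * (W x / \<rho> 2 x)) * M"
      using g[of x] abs_ge_zero[of "g x"] by (intro mult_mono g M) auto
    finally show "\<bar>g x * \<bar>w x\<bar>\<bar> \<le> (K * M) * (W x / \<rho> 2 x)" by (simp add: mult_ac)
  qed
qed

lemma integrable_hardy: "integrable lborel (\<lambda>x. W x / \<rho> l x * \<bar>w x\<bar>)" if "2 \<le> l"
  using weight_div_le[OF that]
  by (intro integrable_times_test_function[where K = 1]) (auto simp: weight_nonneg)

lemma energy_nonneg: "0 \<le> energy w"
  unfolding energy_def by (intro Bochner_Integration.integral_nonneg mult_nonneg_nonneg weight_nonneg norm_ge_zero)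

text \<open>Integration by parts against \<open>|w|\<close> on each line parallel to axis
  \<open>k\<close>, then \<open>|vfield| \<le> W\<close> and
  \<open>|partial_deriv k w| \<le> |grad w|\<close>.\<close>

lemma integral_dvfield_le:
  assumes l: "2 \<le> l" and k: "k \<in> e ` {1..l}"
  shows "integrable lborel (\<lambda>x. dvfield e \<sigma> l k x * \<bar>w x\<bar>)"
    and "(LINT x|lborel. dvfield e \<sigma> l k x * \<bar>w x\<bar>) \<le> energy w"
proof -
  show i1: "integrable lborel (\<lambda>x. dvfield e \<sigma> l k x * \<bar>w x\<bar>)"
    by (intro integrable_times_test_function[OF _ abs_dvfield_le[OF k l]]) measurable
  have vle: "\<bar>vfield e \<sigma> l k x\<bar> * \<bar>partial_deriv k w x\<bar> \<le> W x * norm (grad w x)" for x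
    by (intro mult_mono abs_vfield_le[OF k] abs_partial_deriv_le[OF w] weight_nonneg) auto
  have i2: "integrable lborel (\<lambda>x. \<bar>vfield e \<sigma> l k x\<bar> * \<bar>partial_deriv k w x\<bar>)"
    by (rule Bochner_Integration.integrable_bound[OF integrable_energy])
      (auto simp: abs_mult weight_nonneg intro!: AE_I2 vle)
  define h where "h x = \<bar>vfield e \<sigma> l k x\<bar> * \<bar>partial_deriv k w x\<bar> - dvfield e \<sigma> l k x * \<bar>w x\<bar>" for x
  \<comment> \<open>The integral must be nonnegative on every line, but integration by parts works
    only on generic ones. The condition does not involve \<open>x_k\<close>, so \<open>h'\<close> is
    either \<open>h\<close> or zero on an entire line.\<close>
  define h' where "h' x = (if \<forall>j. j \<noteq> k \<longrightarrow> x $ j \<noteq> 0 then h x else 0)" for x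
  have ih: "integrable lborel h" unfolding h_def by (intro Bochner_Integration.integrable_diff i1 i2)
  then have [measurable]: "h \<in> borel_measurable borel" by auto
  have [measurable]: "h' \<in> borel_measurable borel"
  proof -
    have "{x :: real ^ 'n. \<forall>j. j \<noteq> k \<longrightarrow> x $ j \<noteq> 0} = (\<Inter>j\<in>-{k}. {x. x $ j \<noteq> 0})" by auto
    also have "\<dots> \<in> sets borel"
    proof (cases "-{k} = {}")
      case False
      then show ?thesis by (intro sets.finite_INT) auto
    qed simp
    finally have "{x :: real ^ 'n. \<forall>j. j \<noteq> k \<longrightarrow> x $ j \<noteq> 0} \<in> sets borel" .
    then have "(\<lambda>x. if x \<in> {x :: real ^ 'n. \<forall>j. j \<noteq> k \<longrightarrow> x $ j \<noteq> 0} then h x else 0) \<in> borel_measurable borel"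
      by (intro measurable_If_set) simp_all
    then show ?thesis by (simp add: h'_def[abs_def])
  qed
  have ae: "AE x in lborel. h x = h' x"
    using AE_lborel_nonzero by eventually_elim (simp add: h'_def)
  have ih': "integrable lborel h'"
    using ih ae by (subst integrable_cong_AE[symmetric]) auto
  obtain R where R: "0 \<le> R" "\<And>x i. R \<le> \<bar>x $ i\<bar> \<Longrightarrow> w x = 0" "\<And>x i k. R \<le> \<bar>x $ i\<bar> \<Longrightarrow> partial_deriv k w x = 0"
    by (rule test_function_support[OF w]) blast
  have "0 \<le> integral\<^sup>L lborel h'"
  proof (rule integral_nonneg_lines[OF ih', of k])
    fix x
    show "0 \<le> (LINT t|lborel. h' (upd k t x))"
    proof (cases "\<forall>j. j \<noteq> k \<longrightarrow> x $ j \<noteq> 0")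
      case True
      then have x: "\<And>j. j \<noteq> k \<Longrightarrow> x $ j \<noteq> 0" by blast
      have "0 \<le> (LINT t|lborel. h (upd k t x))"
        unfolding h_def
      proof (rule integral_by_parts_abs[where R = R])
        show "continuous_on UNIV (\<lambda>t. dvfield e \<sigma> l k (upd k t x))"
          by (rule continuous_dvfield_line) (use x l in auto)
        show "continuous_on UNIV (\<lambda>t. partial_deriv k w (upd k t x))"
          by (rule continuous_on_compose2[OF test_function_continuous(2)[OF w] continuous_upd]) auto
        show "w (upd k t x) = 0" if "R \<le> \<bar>t\<bar>" for t
          by (rule R(2)[of _ k]) (use that in simp)
        show "partial_deriv k w (upd k t x) = 0" if "R \<le> \<bar>t\<bar>" for t
          by (rule R(3)[of _ k]) (use that in simp)
        show "((\<lambda>t. vfield e \<sigma> l k (upd k t x)) has_real_derivative dvfield e \<sigma> l k (upd k t x)) (at t)" for t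
          by (rule vfield_line_derivative) (use x l k in auto)
      qed (use R(1) test_function_line_derivative[OF w] in auto)
      also have "(\<lambda>t. h (upd k t x)) = (\<lambda>t. h' (upd k t x))"
        using x by (auto simp: h'_def fun_eq_iff)
      finally show ?thesis .
    next
      case False
      then have "h' (upd k t x) = 0" for t by (auto simp: h'_def)
      then show ?thesis by simp
    qed
  qed
  also have "integral\<^sup>L lborel h' = integral\<^sup>L lborel h"
    using ae by (intro integral_cong_AE) auto
  also have "\<dots> = (LINT x|lborel. \<bar>vfield e \<sigma> l k x\<bar> * \<bar>partial_deriv k w x\<bar>) - (LINT x|lborel. dvfield e \<sigma> l k x * \<bar>w x\<bar>)"
    unfolding h_def by (intro Bochner_Integration.integral_diff i1 i2)
  finally show "(LINT x|lborel. dvfield e \<sigma> l k x * \<bar>w x\<bar>) \<le> energy w"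
    using integral_mono[OF i2 integrable_energy vle] unfolding energy_def by linarith
qed

text \<open>The divergence estimate is multiplied by \<open>|w|\<close> and integrated. Each of the
  \<open>l\<close> components of \<open>V_l\<close> is charged the full energy, whence the factor
  \<open>l\<close>.\<close>

lemma hardy_step:
  assumes l: "2 \<le> l" "l \<le> CARD('n)"
  shows "((\<Sum>j=2..l. \<sigma> j) + real l - 1) * (LINT x|lborel. W x / \<rho> l x * \<bar>w x\<bar>)
    \<le> real l * energy w + (\<Sum>j=Suc l..CARD('n). \<bar>\<sigma> j\<bar> * (LINT x|lborel. W x / \<rho> j x * \<bar>w x\<bar>))"
proof -
  let ?c = "(\<Sum>j=2..l. \<sigma> j) + real l - 1"
  let ?f = "\<lambda>x. ?c * (W x / \<rho> l x * \<bar>w x\<bar>) - (\<Sum>j=Suc l..CARD('n). \<bar>\<sigma> j\<bar> * (W x / \<rho> j x * \<bar>w x\<bar>))"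
  let ?g = "\<lambda>x. \<Sum>k\<in>e ` {1..l}. dvfield e \<sigma> l k x * \<bar>w x\<bar>"
  have ij: "integrable lborel (\<lambda>x. \<bar>\<sigma> j\<bar> * (W x / \<rho> j x * \<bar>w x\<bar>))" if "j \<in> {Suc l..CARD('n)}" for j
    using that l by (intro integrable_mult_right integrable_hardy) auto
  have il: "integrable lborel (\<lambda>x. ?c * (W x / \<rho> l x * \<bar>w x\<bar>))"
    using l by (intro integrable_mult_right integrable_hardy) auto
  have i: "integrable lborel ?f"
    by (intro Bochner_Integration.integrable_diff Bochner_Integration.integrable_sum il ij)
  have ig: "integrable lborel ?g"
    using l by (intro Bochner_Integration.integrable_sum integral_dvfield_le) auto
  have "?c * (LINT x|lborel. W x / \<rho> l x * \<bar>w x\<bar>) -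
     (\<Sum>j=Suc l..CARD('n). \<bar>\<sigma> j\<bar> * (LINT x|lborel. W x / \<rho> j x * \<bar>w x\<bar>)) = (LINT x|lborel. ?f x)"
    by (simp only: Bochner_Integration.integral_diff[OF il Bochner_Integration.integrable_sum[OF ij]]
      Bochner_Integration.integral_sum[OF ij] integral_mult_right_zero)
  also have "\<dots> \<le> (LINT x|lborel. ?g x)"
  proof (rule integral_mono_AE[OF i ig], use AE_lborel_nonzero in eventually_elim)
    fix x :: "real ^ 'n"
    assume x: "\<forall>i. x $ i \<noteq> 0"
    have p: "0 < \<rho> 2 x" by (rule norm_trunc_pos[of "e 1"]) (use x in auto)
    show "?f x \<le> ?g x"
      using mult_right_mono[OF divergence_vfield_ge[OF p l, of \<sigma>] abs_ge_zero[of "w x"]]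
      by (simp add: left_diff_distrib sum_distrib_right mult.assoc)
  qed
  also have "\<dots> = (\<Sum>k\<in>e ` {1..l}. LINT x|lborel. dvfield e \<sigma> l k x * \<bar>w x\<bar>)"
    using l by (intro Bochner_Integration.integral_sum integral_dvfield_le) auto
  also have "\<dots> \<le> (\<Sum>k\<in>e ` {1..l}. energy w)"
    using l by (intro sum_mono integral_dvfield_le) auto
  also have "\<dots> = real l * energy w" using card_e[OF l(2)] by simp
  finally show ?thesis by simp
qed

end

text \<open>Downward induction on \<open>l\<close>: the error terms of the previous step involve
  only \<open>j > l\<close>, and for \<open>l = n\<close> there are none. Positivity of
  \<open>c_l\<close> allows the final division.\<close>

lemma hardy:
  assumes "2 \<le> l" "l \<le> CARD('n)"
  shows "\<exists>K\<ge>0. \<forall>w\<in>test_functions. (LINT x|lborel. W x / \<rho> l x * \<bar>w x\<bar>) \<le> K * energy w"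
  using assms
proof (induction "CARD('n) - l" arbitrary: l rule: less_induct)
  case less
  have "\<forall>j\<in>{Suc l..CARD('n)}. \<exists>K\<ge>0. \<forall>w\<in>test_functions. (LINT x|lborel. W x / \<rho> j x * \<bar>w x\<bar>) \<le> K * energy w"
    using less.prems by (intro ballI less.hyps) auto
  then obtain K where "\<forall>j\<in>{Suc l..CARD('n)}. 0 \<le> K j \<and>
      (\<forall>w\<in>test_functions. (LINT x|lborel. W x / \<rho> j x * \<bar>w x\<bar>) \<le> K j * energy w)"
    unfolding bchoice_iff by blast
  then have K: "\<And>j. j \<in> {Suc l..CARD('n)} \<Longrightarrow> 0 \<le> K j"
    "\<And>j w. j \<in> {Suc l..CARD('n)} \<Longrightarrow> w \<in> test_functions \<Longrightarrow> (LINT x|lborel. W x / \<rho> j x * \<bar>w x\<bar>) \<le> K j * energy w"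
    by blast+
  define c where "c = (\<Sum>j=2..l. \<sigma> j) + real l - 1"
  have c: "0 < c" using c_pos[of l] less.prems by (simp add: c_def)
  define K' where "K' = real l + (\<Sum>j=Suc l..CARD('n). \<bar>\<sigma> j\<bar> * K j)"
  have K': "0 \<le> K'" unfolding K'_def using K(1) by (intro add_nonneg_nonneg sum_nonneg) auto
  have "(LINT x|lborel. W x / \<rho> l x * \<bar>w x\<bar>) \<le> K' / c * energy w" if w: "w \<in> test_functions" for w
  proof -
    have "c * (LINT x|lborel. W x / \<rho> l x * \<bar>w x\<bar>)
      \<le> real l * energy w + (\<Sum>j=Suc l..CARD('n). \<bar>\<sigma> j\<bar> * (LINT x|lborel. W x / \<rho> j x * \<bar>w x\<bar>))"
      unfolding c_def by (rule hardy_step[OF w less.prems])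
    also have "\<dots> \<le> real l * energy w + (\<Sum>j=Suc l..CARD('n). \<bar>\<sigma> j\<bar> * (K j * energy w))"
      using K(2)[OF _ w] by (intro add_left_mono sum_mono mult_left_mono) auto
    also have "\<dots> = K' * energy w"
      by (simp add: K'_def distrib_right sum_distrib_right mult.assoc)
    finally show ?thesis using c by (simp add: pos_le_divide_eq mult.commute)
  qed
  then show ?case using K' c by (intro exI[of _ "K' / c"]) auto
qed

end

section \<open>The Sobolev inequality and interpolation\<close>

context weights
begin

text \<open>Gagliardo--Nirenberg for \<open>W w\<close>: the derivative that falls on
  \<open>W\<close> costs a multiple of \<open>W |w| / |X_2|\<close>, which Hardy's inequality turns
  into energy.\<close>

lemma sobolev:
  "\<exists>K\<ge>0. \<forall>w\<in>test_functions. (\<integral>\<^sup>+x. ennreal ((W x * \<bar>w x\<bar>) powr (CARD('n) / (CARD('n) - 1))) \<partial>lborel)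
     \<le> ennreal ((K * energy w) powr (CARD('n) / (CARD('n) - 1)))"
proof -
  let ?p = "real CARD('n) / real (CARD('n) - 1)"
  have p: "0 \<le> ?p" by simp
  obtain K where K: "0 \<le> K" "\<And>w. w \<in> test_functions \<Longrightarrow> (LINT x|lborel. W x / \<rho> 2 x * \<bar>w x\<bar>) \<le> K * energy w"
    using hardy[of 2] card_ge_2 by auto
  define S where "S = (\<Sum>j=2..CARD('n). \<bar>\<sigma> j\<bar>)"
  have S: "0 \<le> S" unfolding S_def by (intro sum_nonneg) auto
  have "(\<integral>\<^sup>+x. ennreal ((W x * \<bar>w x\<bar>) powr ?p) \<partial>lborel) \<le> ennreal (((1 + S * K) * energy w) powr ?p)"
    if w: "w \<in> test_functions" for w
  proof -
    note [measurable] = test_function_measurable[OF w]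
    \<comment> \<open>One function that dominates the derivatives of \<open>W w\<close> in all
      directions, as the Loomis--Whitney inequality requires.\<close>
    define g where "g x = W x * norm (grad w x) + S * (W x / \<rho> 2 x * \<bar>w x\<bar>)" for x
    have g0: "0 \<le> g x" for x
      unfolding g_def using S by (intro add_nonneg_nonneg mult_nonneg_nonneg divide_nonneg_nonneg weight_nonneg) auto
    have ig: "integrable lborel g"
      unfolding g_def by (intro Bochner_Integration.integrable_add integrable_mult_right integrable_energy integrable_hardy w order_refl)
    have [measurable]: "g \<in> borel_measurable borel" using ig by auto
    \<comment> \<open>Setting \<open>f\<close> to zero on the coordinate hyperplanes makes the line
      bound trivial at points whose lines may hit the singular set.\<close>
    define f where "f x = (if \<forall>j. x $ j \<noteq> 0 then W x * \<bar>w x\<bar> else 0)" for x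
    have f0: "0 \<le> f x" for x by (simp add: f_def weight_nonneg)
    have [measurable]: "f \<in> borel_measurable borel"
    proof -
      have "{x :: real ^ 'n. \<forall>j. x $ j \<noteq> 0} = (\<Inter>j. {x. x $ j \<noteq> 0})" by auto
      also have "\<dots> \<in> sets borel" by (intro sets.finite_INT) auto
      finally have "{x :: real ^ 'n. \<forall>j. x $ j \<noteq> 0} \<in> sets borel" .
      then have "(\<lambda>x. if x \<in> {x :: real ^ 'n. \<forall>j. x $ j \<noteq> 0} then W x * \<bar>w x\<bar> else 0) \<in> borel_measurable borel"
        by (intro measurable_If_set) simp_all
      then show ?thesis by (simp add: f_def[abs_def])
    qed
    have "(\<integral>\<^sup>+x. ennreal ((W x * \<bar>w x\<bar>) powr ?p) \<partial>lborel) = (\<integral>\<^sup>+x. ennreal (f x powr ?p) \<partial>lborel)"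
      by (rule nn_integral_cong_AE, use AE_lborel_nonzero in eventually_elim) (simp add: f_def)
    also have "\<dots> \<le> epow (\<integral>\<^sup>+x. ennreal (g x) \<partial>lborel) ?p"
    proof (rule nn_integral_Loomis_Whitney[OF _ card_ge_2])
      fix x i
      show "ennreal (f x) \<le> (\<integral>\<^sup>+t. ennreal (g (upd i t x)) \<partial>lborel)"
      proof (cases "\<forall>j. x $ j \<noteq> 0")
        case True
        then have x: "\<And>j. j \<noteq> i \<Longrightarrow> x $ j \<noteq> 0" by blast
        obtain R where R: "0 \<le> R" "\<And>x i. R \<le> \<bar>x $ i\<bar> \<Longrightarrow> w x = 0"
          by (rule test_function_support[OF w]) blast
        let ?u = "\<lambda>t. W (upd i t x) * w (upd i t x)"
        let ?u' = "\<lambda>t. dweight e \<sigma> i (upd i t x) * w (upd i t x) + partial_deriv i w (upd i t x) * W (upd i t x)"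
        have "f x = \<bar>?u (x $ i)\<bar>"
          using True by (simp add: f_def abs_mult weight_nonneg)
        also have "ennreal \<dots> \<le> (\<integral>\<^sup>+t. ennreal \<bar>?u' t\<bar> \<partial>lborel)"
        proof (rule abs_le_nn_integral_derivative[where R = R and u = ?u and u' = ?u' and s = "x $ i"])
          show "(?u has_real_derivative ?u' t) (at t)" for t
            by (intro DERIV_mult weight_line_derivative test_function_line_derivative[OF w] x)
          have "continuous_on UNIV (\<lambda>t. w (upd i t x))"
            by (rule continuous_on_compose2[OF test_function_continuous(1)[OF w] continuous_upd]) auto
          moreover have "continuous_on UNIV (\<lambda>t. partial_deriv i w (upd i t x))"
            by (rule continuous_on_compose2[OF test_function_continuous(2)[OF w] continuous_upd]) auto
          ultimately show "continuous_on UNIV ?u'"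
            by (intro continuous_on_add continuous_on_mult continuous_dweight_line continuous_weight_line x)
          show "?u t = 0" if "R \<le> \<bar>t\<bar>" for t
          proof -
            have "w (upd i t x) = 0" by (rule R(2)[of _ i]) (use that in simp)
            then show ?thesis by simp
          qed
        qed (rule R(1))
        also have "\<dots> \<le> (\<integral>\<^sup>+t. ennreal (g (upd i t x)) \<partial>lborel)"
        proof (intro nn_integral_mono ennreal_leI)
          fix t
          let ?y = "upd i t x"
          have "\<bar>?u' t\<bar> \<le> \<bar>dweight e \<sigma> i ?y\<bar> * \<bar>w ?y\<bar> + W ?y * \<bar>partial_deriv i w ?y\<bar>"
            by (rule order_trans[OF abs_triangle_ineq]) (simp add: abs_mult weight_nonneg)
          moreover have "\<bar>dweight e \<sigma> i ?y\<bar> * \<bar>w ?y\<bar> \<le> (S * (W ?y / \<rho> 2 ?y)) * \<bar>w ?y\<bar>"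
            unfolding S_def by (intro mult_right_mono abs_dweight_le) auto
          moreover have "W ?y * \<bar>partial_deriv i w ?y\<bar> \<le> W ?y * norm (grad w ?y)"
            by (intro mult_left_mono abs_partial_deriv_le[OF w] weight_nonneg)
          ultimately show "\<bar>?u' t\<bar> \<le> g ?y"
            unfolding g_def mult.assoc by linarith
        qed
        finally show ?thesis .
      qed (auto simp: f_def)
    qed (use f0 in auto)
    also have "(\<integral>\<^sup>+x. ennreal (g x) \<partial>lborel) = ennreal (integral\<^sup>L lborel g)"
      by (intro nn_integral_eq_integral ig AE_I2 g0)
    also have "integral\<^sup>L lborel g = energy w + S * (LINT x|lborel. W x / \<rho> 2 x * \<bar>w x\<bar>)"
      unfolding g_def energy_def
      by (subst Bochner_Integration.integral_add)
        (intro integrable_mult_right integrable_energy integrable_hardy w order_refl refl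
          integral_mult_right_zero arg_cong2[where f = "(+)"])+
    also have "epow (ennreal \<dots>) ?p \<le> epow (ennreal ((1 + S * K) * energy w)) ?p"
      using mult_left_mono[OF K(2)[OF w] S] p
      by (intro epow_mono ennreal_leI) (simp_all add: distrib_right mult.assoc)
    also have "\<dots> = ennreal (((1 + S * K) * energy w) powr ?p)"
      using S K(1) energy_nonneg[OF w] by (intro epow_ennreal) simp
    finally show ?thesis .
  qed
  moreover have "0 \<le> 1 + S * K" using S K(1) by simp
  ultimately show ?thesis by blast
qed

text \<open>Almost everywhere the integrand is the Hardy integrand to the power \<open>a\<close>
  times the Sobolev integrand to the power \<open>c\<close>, with \<open>a + c = 1\<close>.\<close>

lemma weighted_interpolation:
  assumes q: "1 < q" "q \<le> real CARD('n) / (real CARD('n) - 1)"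
    and b: "b = \<sigma> 2 - 1 + (q - 1) / q * real CARD('n)"
  shows "\<exists>K\<ge>0. \<forall>w\<in>test_functions.
    (\<integral>\<^sup>+x. ennreal ((\<rho> 2 x powr b * weight e \<sigma> 3 x * \<bar>w x\<bar>) powr q) \<partial>lborel) \<le> ennreal (K * energy w powr q)"
proof -
  define n where "n = real CARD('n)"
  have n: "2 \<le> n" using card_ge_2 by (simp add: n_def)
  have n1: "real (CARD('n) - 1) = n - 1" using card_ge_2 by (simp add: n_def of_nat_diff)
  define p where "p = n / (n - 1)"
  \<comment> \<open>The solution of \<open>a + c = 1\<close> and \<open>a + p * c = q\<close>; the
    value of \<open>b\<close> is what makes \<open>(b - \<sigma> 2) * q = - a\<close>.\<close>
  define c where "c = (n - 1) * (q - 1)"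
  define a where "a = 1 - c"
  have c: "0 < c" using n q by (simp add: c_def)
  have "q * (n - 1) \<le> n" using q(2) n unfolding n_def[symmetric] by (simp add: pos_le_divide_eq)
  then have a: "0 \<le> a" by (simp add: a_def c_def algebra_simps)
  have pc: "p * c = n * (q - 1)" using n by (simp add: p_def c_def)
  have apc: "a + p * c = q" unfolding pc by (simp add: a_def c_def algebra_simps)
  have bq: "(b - \<sigma> 2) * q = - a" using q unfolding b a_def c_def n_def[symmetric] by (simp add: field_simps)
  obtain K1 where K1: "0 \<le> K1" "\<And>w. w \<in> test_functions \<Longrightarrow> (LINT x|lborel. W x / \<rho> 2 x * \<bar>w x\<bar>) \<le> K1 * energy w"
    using hardy[of 2] card_ge_2 by auto
  obtain K2 where K2: "0 \<le> K2" "\<And>w. w \<in> test_functions \<Longrightarrow>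
      (\<integral>\<^sup>+x. ennreal ((W x * \<bar>w x\<bar>) powr p) \<partial>lborel) \<le> ennreal ((K2 * energy w) powr p)"
    using sobolev unfolding n1 n_def[symmetric] p_def[symmetric] by blast
  have eq: "(\<rho> 2 x powr b * weight e \<sigma> 3 x * \<bar>w x\<bar>) powr q =
      (W x / \<rho> 2 x * \<bar>w x\<bar>) powr a * ((W x * \<bar>w x\<bar>) powr p) powr c" if x: "\<forall>i. x $ i \<noteq> 0" for x w
  proof -
    have r: "0 < \<rho> 2 x" by (rule norm_trunc_pos[of "e 1"]) (use x in auto)
    define Y where "Y = W x * \<bar>w x\<bar>"
    have Y: "0 \<le> Y" by (simp add: Y_def weight_nonneg)
    have "{2..CARD('n)} = insert 2 {3..CARD('n)}" using card_ge_2 by auto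
    then have "W x = \<rho> 2 x powr \<sigma> 2 * weight e \<sigma> 3 x" by (simp add: weight_def)
    then have "\<rho> 2 x powr b * weight e \<sigma> 3 x * \<bar>w x\<bar> = \<rho> 2 x powr (b - \<sigma> 2) * Y"
      using r by (simp add: Y_def powr_diff)
    then have "(\<rho> 2 x powr b * weight e \<sigma> 3 x * \<bar>w x\<bar>) powr q = \<rho> 2 x powr - a * Y powr (a + p * c)"
      using Y by (simp add: powr_mult powr_powr bq apc)
    also have "\<dots> = (Y / \<rho> 2 x) powr a * (Y powr p) powr c"
      using Y r by (simp add: powr_add powr_powr powr_divide powr_minus_divide)
    finally show ?thesis by (simp add: Y_def)
  qed
  show ?thesis
  \<comment> \<open>Hoelder's inequality was proved for positive exponents, so the endpoint
    \<open>q = n / (n - 1)\<close> is read off from \<open>sobolev\<close> directly.\<close>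
  proof (cases "a = 0")
    case True
    then have c1: "c = 1" "p = q" using apc by (auto simp: a_def)
    have "(\<integral>\<^sup>+x. ennreal ((\<rho> 2 x powr b * weight e \<sigma> 3 x * \<bar>w x\<bar>) powr q) \<partial>lborel) \<le> ennreal (K2 powr q * energy w powr q)"
      if w: "w \<in> test_functions" for w
    proof -
      have "(\<integral>\<^sup>+x. ennreal ((\<rho> 2 x powr b * weight e \<sigma> 3 x * \<bar>w x\<bar>) powr q) \<partial>lborel)
         = (\<integral>\<^sup>+x. ennreal ((W x * \<bar>w x\<bar>) powr p) \<partial>lborel)"
      proof (rule nn_integral_cong_AE, use AE_lborel_nonzero in eventually_elim)
        fix x :: "real ^ 'n"
        assume x: "\<forall>i. x $ i \<noteq> 0"
        have r: "0 < \<rho> 2 x" by (rule norm_trunc_pos[of "e 1"]) (use x in auto)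
        show "ennreal ((\<rho> 2 x powr b * weight e \<sigma> 3 x * \<bar>w x\<bar>) powr q) = ennreal ((W x * \<bar>w x\<bar>) powr p)"
          \<comment> \<open>The factor with exponent 0 is 1 only where \<open>W x * w x\<close> is
            nonzero, as \<open>0 powr 0 = 0\<close>; elsewhere both sides vanish.\<close>
          unfolding eq[OF x] True c1(1) using r by (cases "W x * w x = 0") (auto simp: weight_nonneg)
      qed
      also have "\<dots> \<le> ennreal ((K2 * energy w) powr p)" by (rule K2(2)[OF w])
      finally show ?thesis using K2(1) energy_nonneg[OF w] by (simp add: powr_mult c1)
    qed
    then show ?thesis by (intro exI[of _ "K2 powr q"]) auto
  next
    case False
    then have a: "0 < a" using a by simp
    have "(\<integral>\<^sup>+x. ennreal ((\<rho> 2 x powr b * weight e \<sigma> 3 x * \<bar>w x\<bar>) powr q) \<partial>lborel)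
        \<le> ennreal (K1 powr a * K2 powr (p * c) * energy w powr q)"
      if w: "w \<in> test_functions" for w
    proof -
      note [measurable] = test_function_measurable[OF w]
      let ?A = "\<lambda>x. ennreal (W x / \<rho> 2 x * \<bar>w x\<bar>)" and ?B = "\<lambda>x. ennreal ((W x * \<bar>w x\<bar>) powr p)"
      \<comment> \<open>Two-factor Hoelder as the general version indexed by
        \<open>bool\<close>.\<close>
      let ?f = "\<lambda>i x. if i then ?A x else ?B x" and ?e = "\<lambda>i. if i then a else c"
      have E: "0 \<le> energy w" by (rule energy_nonneg[OF w])
      have A: "(\<integral>\<^sup>+x. ?A x \<partial>lborel) \<le> ennreal (K1 * energy w)"
        using K1(2)[OF w] nn_integral_eq_integral[OF integrable_hardy[OF w order_refl]]
        by (simp add: weight_nonneg ennreal_leI)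
      have "(\<integral>\<^sup>+x. ennreal ((\<rho> 2 x powr b * weight e \<sigma> 3 x * \<bar>w x\<bar>) powr q) \<partial>lborel)
         = (\<integral>\<^sup>+x. (\<Prod>i\<in>UNIV. epow (?f i x) (?e i)) \<partial>lborel)"
      proof (rule nn_integral_cong_AE, use AE_lborel_nonzero in eventually_elim)
        fix x :: "real ^ 'n"
        assume x: "\<forall>i. x $ i \<noteq> 0"
        show "ennreal ((\<rho> 2 x powr b * weight e \<sigma> 3 x * \<bar>w x\<bar>) powr q) = (\<Prod>i\<in>UNIV. epow (?f i x) (?e i))"
          unfolding eq[OF x] ennreal_mult[OF powr_ge_zero powr_ge_zero]
          by (simp add: UNIV_bool epow_ennreal weight_nonneg mult.commute)
      qed
      also have "\<dots> \<le> (\<Prod>i\<in>UNIV. epow (\<integral>\<^sup>+x. ?f i x \<partial>lborel) (?e i))"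
        using a c by (intro nn_integral_Holder) (auto simp: UNIV_bool a_def)
      also have "\<dots> = epow (\<integral>\<^sup>+x. ?B x \<partial>lborel) c * epow (\<integral>\<^sup>+x. ?A x \<partial>lborel) a"
        by (simp add: UNIV_bool)
      also have "\<dots> \<le> epow (ennreal ((K2 * energy w) powr p)) c * epow (ennreal (K1 * energy w)) a"
        using a c by (intro mult_mono epow_mono A K2(2)[OF w]) auto
      also have "\<dots> = ennreal (((K2 * energy w) powr p) powr c * (K1 * energy w) powr a)"
        by (simp only: epow_ennreal[OF powr_ge_zero] epow_ennreal[OF mult_nonneg_nonneg[OF K1(1) E]]
          ennreal_mult[OF powr_ge_zero powr_ge_zero])
      also have "((K2 * energy w) powr p) powr c * (K1 * energy w) powr a
          = K1 powr a * K2 powr (p * c) * energy w powr (a + p * c)"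
        using K1 K2 E by (simp add: powr_mult powr_powr powr_add mult_ac)
      finally show ?thesis unfolding apc .
    qed
    then show ?thesis by (intro exI[of _ "K1 powr a * K2 powr (p * c)"]) auto
  qed
qed

end

text \<open>A non-integrable function has Bochner integral 0, so the two integrability claims give
  the inequality its intended meaning. For \<open>n = 2\<close> the factor
  \<open>weight e \<sigma> 3\<close> is an empty product, equal to 1.\<close>

theorem theorem3p1:
  fixes e :: "nat \<Rightarrow> 'n::finite" and \<sigma> :: "nat \<Rightarrow> real" and n :: nat and q b :: real
  assumes n_card: "n = CARD('n)" and n_ge_2: "n \<ge> 2"
    and numbering: "bij_betw e {1..n} UNIV"
    and c_pos: "\<And>l. l \<in> {2..n} \<Longrightarrow> \<sigma> l \<noteq> 0 \<Longrightarrow> (\<Sum>j=2..l. \<sigma> j) + real l - 1 > 0"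
    and q_gt: "1 < q" and q_le: "q \<le> real n / (real n - 1)"
    and b_eq: "b = \<sigma> 2 - 1 + (q - 1) / q * real n"
  shows "\<exists>C>0. \<forall>w\<in>(test_functions :: (real ^ 'n \<Rightarrow> real) set).
    integrable lborel (\<lambda>x. weight e \<sigma> 2 x * norm (grad w x)) \<and>
    integrable lborel
      (\<lambda>x. (norm (trunc e 2 x) powr b * weight e \<sigma> 3 x * \<bar>w x\<bar>) powr q) \<and>
    (LINT x|lborel. weight e \<sigma> 2 x * norm (grad w x)) \<ge>
      C * (LINT x|lborel.
             (norm (trunc e 2 x) powr b * weight e \<sigma> 3 x * \<bar>w x\<bar>) powr q) powr (1 / q)"
proof -
  \<comment> \<open>If \<open>\<sigma> l = 0\<close>, then \<open>c_l = c_(l-1) + 1\<close>, and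
    \<open>c_2 = 1\<close> in the base case; so positivity passes over vanishing exponents.\<close>
  have c: "0 < (\<Sum>j=2..l. \<sigma> j) + real l - 1" if "2 \<le> l" "l \<le> n" for l
    using that
  proof (induction l rule: nat_induct_at_least)
    case base
    then show ?case using c_pos[of 2] by (cases "\<sigma> 2 = 0") auto
  next
    case (Suc l)
    then show ?case using c_pos[of "Suc l"] by (cases "\<sigma> (Suc l) = 0") auto
  qed
  interpret weights e \<sigma>
    using numbering n_ge_2 c unfolding n_card by unfold_locales auto
  obtain K where K: "0 \<le> K" "\<And>w. w \<in> test_functions \<Longrightarrow>
      (\<integral>\<^sup>+x. ennreal ((\<rho> 2 x powr b * weight e \<sigma> 3 x * \<bar>w x\<bar>) powr q) \<partial>lborel) \<le> ennreal (K * energy w powr q)"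
    using weighted_interpolation[of q b] q_gt q_le b_eq unfolding n_card by blast
  \<comment> \<open>The \<open>+ 1\<close> keeps \<open>C\<close> well defined and positive if
    \<open>K = 0\<close>.\<close>
  define C where "C = 1 / (K powr (1 / q) + 1)"
  have "0 < K powr (1 / q) + 1" by (intro add_nonneg_pos) auto
  then have C: "0 < C" "C * K powr (1 / q) \<le> 1" by (simp_all add: C_def)
  show ?thesis
  proof (intro exI[of _ C] conjI ballI C(1))
    fix w :: "real ^ 'n \<Rightarrow> real"
    assume w: "w \<in> test_functions"
    note [measurable] = test_function_measurable[OF w]
    let ?Q = "\<lambda>x. (\<rho> 2 x powr b * weight e \<sigma> 3 x * \<bar>w x\<bar>) powr q"
    show "integrable lborel (\<lambda>x. W x * norm (grad w x))" by (rule integrable_energy[OF w])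
    show iQ: "integrable lborel ?Q"
    proof (rule integrableI_bounded)
      show "(\<integral>\<^sup>+x. ennreal (norm (?Q x)) \<partial>lborel) < \<infinity>"
        using K(2)[OF w] by (simp add: le_less_trans[OF _ ennreal_less_top])
    qed measurable
    have "ennreal (LINT x|lborel. ?Q x) = (\<integral>\<^sup>+x. ennreal (?Q x) \<partial>lborel)"
      by (rule nn_integral_eq_integral[symmetric, OF iQ]) auto
    also note K(2)[OF w]
    finally have "(LINT x|lborel. ?Q x) \<le> K * energy w powr q"
      using K(1) by (simp add: ennreal_le_iff)
    then have "(LINT x|lborel. ?Q x) powr (1 / q) \<le> (K * energy w powr q) powr (1 / q)"
      using q_gt by (intro powr_mono2) auto
    also have "\<dots> = K powr (1 / q) * energy w"
      using K(1) q_gt energy_nonneg[OF w] by (simp add: powr_mult powr_powr)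
    finally have "C * (LINT x|lborel. ?Q x) powr (1 / q) \<le> C * (K powr (1 / q) * energy w)"
      using C(1) by (intro mult_left_mono) auto
    also have "\<dots> = (C * K powr (1 / q)) * energy w" by simp
    also have "\<dots> \<le> 1 * energy w" by (intro mult_right_mono C(2) energy_nonneg[OF w])
    finally show "C * (LINT x|lborel. ?Q x) powr (1 / q) \<le> (LINT x|lborel. W x * norm (grad w x))"
      by (simp add: energy_def)
  qed
qed

end
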